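(* Let $\mathbf{u}=(\mathcal{U},\mathcal{W})$ be a $t$-structure in a triangulated category $\mathcal{D}$ with heart $\mathcal{H}$ and extended heart $\mathcal{C}$, and let $\mathsf{E}_{\mathbf{u}}^{+}:\mathsf{stors}\,\mathcal{C}^{+}\to\mathbb{T}_{\mathbf{u}}^{+}$ be the isomorphism of posets given by restricting the extended tilt $\mathsf{E}_{\mathbf{u}}$ to $\mathsf{stors}\,\mathcal{C}^{+}$. Then the following statements hold. (a) The map $\mu^{+}:\mathsf{stors}\,\mathcal{H}\to\mathsf{stors}\,\mathcal{C}^{+}$, $(\mathcal{T},\mathcal{F})\mapsto(\mathcal{T},\mathcal{F}\star\Sigma^{-1}\mathcal{H})$, is an isomorphism of posets whose inverse is $\lambda^{+}:\mathsf{stors}\,\mathcal{C}^{+}\to\mathsf{stors}\,\mathcal{H}$, $(\mathcal{X},\mathcal{Y})\mapsto(\mathcal{X},\mathcal{Y}\cap\mathcal{H})$. Furthermore, $\mathcal{Y}=(\mathcal{Y}\cap\mathcal{H})\star\Sigma^{-1}\mathcal{H}$ for every $(\mathcal{X},\mathcal{Y})\in\mathsf{stors}\,\mathcal{C}^{+}$ and $\mathcal{F}=(\mathcal{F}\star\Sigma^{-1}\mathcal{H})\cap\mathcal{H}$ for every $(\mathcal{T},\mathcal{F})\in\mathsf{stors}\,\mathcal{H}$. (b) $\mathsf{E}_{\mathbf{u}}^{+}\circ\mu^{+}=\mathsf{R}_{\mathbf{u}}$.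
   Context: Let $\mathcal{D}$ be a triangulated category with shift automorphism $\Sigma$. For classes $\mathcal{A},\mathcal{B}\subseteq\mathcal{D}$, $\mathcal{A}\star\mathcal{B}$ is the class of $C\in\mathcal{D}$ admitting a distinguished triangle $A\to C\to B\to\Sigma A$ with $A\in\mathcal{A}$, $B\in\mathcal{B}$. For a full extension-closed subcategory $\mathcal{X}\subseteq\mathcal{D}$, an $s$-torsion pair in $\mathcal{X}$ is a pair $(\mathcal{T},\mathcal{F})$ of full isomorphism-closed subcategories of $\mathcal{X}$ with $\mathrm{Hom}_{\mathcal{D}}(\mathcal{T},\mathcal{F})=0$, $\mathrm{Hom}_{\mathcal{D}}(\mathcal{T},\Sigma^{-1}\mathcal{F})=0$, and $\mathcal{X}=\mathcal{T}\star\mathcal{F}$. $\mathsf{stors}\,\mathcal{X}$ is the poset of $s$-torsion pairs in $\mathcal{X}$ ordered by inclusion of first components. (For $\mathcal{X}$ the heart of a $t$-structure these are the usual torsion pairs.) A $t$-structure in $\mathcal{D}$ is a pair $\mathbf{u}=(\mathcal{U},\mathcal{W})$ of full isomorphism-closed subcategories with $\Sigma\mathcal{U}\subseteq\mathcal{U}$, $\mathrm{Hom}_{\mathcal{D}}(\mathcal{U},\Sigma^{-1}\mathcal{W})=0$ and $\mathcal{D}=\mathcal{U}\star\Sigma^{-1}\mathcal{W}$. Its heart is $\mathcal{H}=\mathcal{U}\cap\mathcal{W}$ and its extended heart is $\mathcal{C}=\mathcal{W}\cap\Sigma^{-1}\mathcal{U}$. $\mathbb{T}_{\mathbf{u}}$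 is the class of $t$-structures $(\mathcal{U}',\mathcal{W}')$ with $\Sigma\mathcal{U}\subseteq\mathcal{U}'\subseteq\Sigma^{-1}\mathcal{U}$, ordered by inclusion of first components, and $\mathbb{T}_{\mathbf{u}}^{+}=\{(\mathcal{U}',\mathcal{W}')\in\mathbb{T}_{\mathbf{u}}:\mathcal{U}'\subseteq\mathcal{U}\}$. $\mathsf{stors}\,\mathcal{C}^{+}=\{(\mathcal{X},\mathcal{Y})\in\mathsf{stors}\,\mathcal{C}:\mathcal{X}\subseteq\mathcal{H}\}$. The extended tilt is the map $\mathsf{E}_{\mathbf{u}}:\mathsf{stors}\,\mathcal{C}\to\mathbb{T}_{\mathbf{u}}$, $(\mathcal{X},\mathcal{Y})\mapsto(\Sigma\mathcal{U}\star\mathcal{X},\ \Sigma\mathcal{Y}\star\Sigma^{-1}\mathcal{W})$; it is an isomorphism of posets which restricts to an isomorphism $\mathsf{stors}\,\mathcal{C}^{+}\to\mathbb{T}_{\mathbf{u}}^{+}$. The right HRS-tilt is the map $\mathsf{R}_{\mathbf{u}}:\mathsf{stors}\,\mathcal{H}\to\mathbb{T}_{\mathbf{u}}^{+}$, $(\mathcal{T},\mathcal{F})\mapsto(\Sigma\mathcal{U}\star\mathcal{T},\ \Sigma\mathcal{F}\star\mathcal{W})$. *)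

theory Defs
  imports "HOL-Algebra.Group" "HOL-Library.FuncSet"
begin

text \<open>
  Full subcategories are given by their sets of objects. Composition is written in the
  order of functions: \<open>comp D g f\<close> is \<open>g\<close> after \<open>f\<close>. Values of the operations outside
  their intended domains are unconstrained.
\<close>

subsection \<open>Additive categories\<close>

record ('o, 'm) category =
  obj :: "'o set"
  arr :: "'m set"
  src :: "'m \<Rightarrow> 'o"
  tgt :: "'m \<Rightarrow> 'o"
  ident :: "'o \<Rightarrow> 'm"
  comp :: "'m \<Rightarrow> 'm \<Rightarrow> 'm"  (infixr \<open>\<cdot>\<index>\<close> 75)

definition Hom :: "('o, 'm, 'e) category_scheme \<Rightarrow> 'o \<Rightarrow> 'o \<Rightarrow> 'm set" where
  "Hom D A B = {f \<in> arr D. src D f = A \<and> tgt D f = B}"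

locale category =
  fixes D (structure)
  assumes src_in_obj: "f \<in> arr D \<Longrightarrow> src D f \<in> obj D"
    and tgt_in_obj: "f \<in> arr D \<Longrightarrow> tgt D f \<in> obj D"
    and ident_in_Hom: "A \<in> obj D \<Longrightarrow> ident D A \<in> Hom D A A"
    and comp_in_Hom: "\<lbrakk>f \<in> Hom D A B; g \<in> Hom D B C\<rbrakk> \<Longrightarrow> g \<cdot> f \<in> Hom D A C"
    and comp_assoc: "\<lbrakk>f \<in> Hom D A B; g \<in> Hom D B C; h \<in> Hom D C E\<rbrakk>
          \<Longrightarrow> (h \<cdot> g) \<cdot> f = h \<cdot> (g \<cdot> f)"
    and comp_ident_right: "f \<in> Hom D A B \<Longrightarrow> f \<cdot> ident D A = f"
    and comp_ident_left: "f \<in> Hom D A B \<Longrightarrow> ident D B \<cdot> f = f"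

definition is_iso :: "('o, 'm, 'e) category_scheme \<Rightarrow> 'o \<Rightarrow> 'o \<Rightarrow> 'm \<Rightarrow> bool" where
  "is_iso D A B f \<longleftrightarrow> f \<in> Hom D A B \<and>
     (\<exists>g \<in> Hom D B A. g \<cdot>\<^bsub>D\<^esub> f = ident D A \<and> f \<cdot>\<^bsub>D\<^esub> g = ident D B)"

definition is_zero_object :: "('o, 'm, 'e) category_scheme \<Rightarrow> 'o \<Rightarrow> bool" where
  "is_zero_object D Z \<longleftrightarrow> Z \<in> obj D \<and>
     (\<forall>A \<in> obj D. (\<exists>!f. f \<in> Hom D A Z) \<and> (\<exists>!f. f \<in> Hom D Z A))"

record ('o, 'm) preadditive_category = "('o, 'm) category" +
  hom_zero :: "'o \<Rightarrow> 'o \<Rightarrow> 'm"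
  hom_add :: "'m \<Rightarrow> 'm \<Rightarrow> 'm"  (infixl \<open>\<oplus>\<^sub>h\<index>\<close> 65)

text \<open>The group of morphisms from \<open>A\<close> to \<open>B\<close>; its multiplication is addition of morphisms.\<close>

definition hom_group ::
  "('o, 'm, 'e) preadditive_category_scheme \<Rightarrow> 'o \<Rightarrow> 'o \<Rightarrow> 'm monoid" where
  "hom_group D A B = \<lparr>carrier = Hom D A B, mult = hom_add D, one = hom_zero D A B\<rparr>"

locale preadditive_category = category D
  for D :: "('o, 'm, 'e) preadditive_category_scheme" (structure) +
  assumes hom_comm_group: "\<lbrakk>A \<in> obj D; B \<in> obj D\<rbrakk> \<Longrightarrow> comm_group (hom_group D A B)"
    and comp_add_left: "\<lbrakk>f \<in> Hom D A B; g \<in> Hom D B C; g' \<in> Hom D B C\<rbrakk>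
          \<Longrightarrow> (g \<oplus>\<^sub>h g') \<cdot> f = (g \<cdot> f) \<oplus>\<^sub>h (g' \<cdot> f)"
    and comp_add_right: "\<lbrakk>f \<in> Hom D A B; f' \<in> Hom D A B; g \<in> Hom D B C\<rbrakk>
          \<Longrightarrow> g \<cdot> (f \<oplus>\<^sub>h f') = (g \<cdot> f) \<oplus>\<^sub>h (g \<cdot> f')"

definition is_biproduct ::
  "('o, 'm, 'e) preadditive_category_scheme \<Rightarrow> 'o \<Rightarrow> 'o \<Rightarrow> 'o \<Rightarrow> 'm \<Rightarrow> 'm \<Rightarrow> 'm \<Rightarrow> 'm \<Rightarrow> bool" where
  "is_biproduct D A B P i j p q \<longleftrightarrow> P \<in> obj D \<and>
     i \<in> Hom D A P \<and> j \<in> Hom D B P \<and> p \<in> Hom D P A \<and> q \<in> Hom D P B \<and>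
     p \<cdot>\<^bsub>D\<^esub> i = ident D A \<and> q \<cdot>\<^bsub>D\<^esub> j = ident D B \<and>
     q \<cdot>\<^bsub>D\<^esub> i = hom_zero D A B \<and> p \<cdot>\<^bsub>D\<^esub> j = hom_zero D B A \<and>
     (i \<cdot>\<^bsub>D\<^esub> p) \<oplus>\<^sub>h\<^bsub>D\<^esub> (j \<cdot>\<^bsub>D\<^esub> q) = ident D P"

locale additive_category = preadditive_category D
  for D :: "('o, 'm, 'e) preadditive_category_scheme" (structure) +
  assumes ex_zero_object: "\<exists>Z. is_zero_object D Z"
    and ex_biproduct: "\<lbrakk>A \<in> obj D; B \<in> obj D\<rbrakk> \<Longrightarrow> \<exists>P i j p q. is_biproduct D A B P i j p q"

subsection \<open>Triangulated categories\<close>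

text \<open>\<open>dist\<close> is the set of distinguished triangles, each given by its three morphisms.\<close>

record ('o, 'm) triangulated_category = "('o, 'm) preadditive_category" +
  shift :: "'o \<Rightarrow> 'o"
  shift_arr :: "'m \<Rightarrow> 'm"
  dist :: "('m \<times> 'm \<times> 'm) set"

definition is_triangle ::
  "('o, 'm, 'e) triangulated_category_scheme \<Rightarrow> 'o \<Rightarrow> 'o \<Rightarrow> 'o \<Rightarrow> 'm \<Rightarrow> 'm \<Rightarrow> 'm \<Rightarrow> bool" where
  "is_triangle D X Y Z f g h \<longleftrightarrow>
     f \<in> Hom D X Y \<and> g \<in> Hom D Y Z \<and> h \<in> Hom D Z (shift D X)"

definition dist_triangle ::
  "('o, 'm, 'e) triangulated_category_scheme \<Rightarrow> 'o \<Rightarrow> 'o \<Rightarrow> 'o \<Rightarrow> 'm \<Rightarrow> 'm \<Rightarrow> 'm \<Rightarrow> bool" where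
  "dist_triangle D X Y Z f g h \<longleftrightarrow> is_triangle D X Y Z f g h \<and> (f, g, h) \<in> dist D"

text \<open>
  Verdier's axioms; the shift is an additive automorphism, i.e. an additive functor that is
  bijective on objects and on morphisms. In \<open>dist_rotate\<close>, \<open>m_inv\<close> in a group of morphisms
  is negation.
\<close>

locale triangulated_category = additive_category D
  for D :: "('o, 'm, 'e) triangulated_category_scheme" (structure) +
  assumes shift_bij: "bij_betw (shift D) (obj D) (obj D)"
    and shift_arr_bij: "bij_betw (shift_arr D) (arr D) (arr D)"
    and shift_arr_in_Hom:
      "f \<in> Hom D A B \<Longrightarrow> shift_arr D f \<in> Hom D (shift D A) (shift D B)"
    and shift_ident: "A \<in> obj D \<Longrightarrow> shift_arr D (ident D A) = ident D (shift D A)"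
    and shift_comp: "\<lbrakk>f \<in> Hom D A B; g \<in> Hom D B C\<rbrakk>
          \<Longrightarrow> shift_arr D (g \<cdot> f) = shift_arr D g \<cdot> shift_arr D f"
    and shift_add: "\<lbrakk>f \<in> Hom D A B; f' \<in> Hom D A B\<rbrakk>
          \<Longrightarrow> shift_arr D (f \<oplus>\<^sub>h f') = shift_arr D f \<oplus>\<^sub>h shift_arr D f'"
    and dist_is_triangle: "(f, g, h) \<in> dist D \<Longrightarrow> \<exists>X Y Z. is_triangle D X Y Z f g h"
    and dist_ident: "\<lbrakk>X \<in> obj D; is_zero_object D Z\<rbrakk>
          \<Longrightarrow> dist_triangle D X X Z (ident D X) (hom_zero D X Z) (hom_zero D Z (shift D X))"
    and ex_dist: "f \<in> Hom D X Y \<Longrightarrow> \<exists>Z g h. dist_triangle D X Y Z f g h"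
    and dist_iso_closed:
      "\<lbrakk>dist_triangle D X Y Z f g h; is_triangle D X' Y' Z' f' g' h';
        is_iso D X X' a; is_iso D Y Y' b; is_iso D Z Z' c;
        b \<cdot> f = f' \<cdot> a; c \<cdot> g = g' \<cdot> b; shift_arr D a \<cdot> h = h' \<cdot> c\<rbrakk>
          \<Longrightarrow> dist_triangle D X' Y' Z' f' g' h'"
    and dist_rotate: "is_triangle D X Y Z f g h \<Longrightarrow>
          dist_triangle D X Y Z f g h \<longleftrightarrow>
          dist_triangle D Y Z (shift D X) g h
            (m_inv (hom_group D (shift D X) (shift D Y)) (shift_arr D f))"
    and dist_morphism:
      "\<lbrakk>dist_triangle D X Y Z f g h; dist_triangle D X' Y' Z' f' g' h';
        a \<in> Hom D X X'; b \<in> Hom D Y Y'; b \<cdot> f = f' \<cdot> a\<rbrakk>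
          \<Longrightarrow> \<exists>c \<in> Hom D Z Z'. c \<cdot> g = g' \<cdot> b \<and> shift_arr D a \<cdot> h = h' \<cdot> c"
    and octahedral:
      "\<lbrakk>dist_triangle D X Y Z' f f' f''; dist_triangle D Y Z X' g g' g'';
        dist_triangle D X Z Y' (g \<cdot> f) h' h''\<rbrakk>
          \<Longrightarrow> \<exists>u v. dist_triangle D Z' Y' X' u v (shift_arr D f' \<cdot> g'') \<and>
                u \<cdot> f' = h' \<cdot> g \<and> v \<cdot> h' = g' \<and>
                h'' \<cdot> u = f'' \<and> g'' \<cdot> v = shift_arr D f \<cdot> h''"

subsection \<open>Classes of objects\<close>

definition shift_class :: "('o, 'm, 'e) triangulated_category_scheme \<Rightarrow> 'o set \<Rightarrow> 'o set" where
  "shift_class D \<A> = shift D ` \<A>"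

definition unshift_class :: "('o, 'm, 'e) triangulated_category_scheme \<Rightarrow> 'o set \<Rightarrow> 'o set" where
  "unshift_class D \<A> = inv_into (obj D) (shift D) ` \<A>"

definition star :: "('o, 'm, 'e) triangulated_category_scheme \<Rightarrow> 'o set \<Rightarrow> 'o set \<Rightarrow> 'o set"
    (infixl \<open>\<star>\<index>\<close> 70) where
  "\<A> \<star>\<^bsub>D\<^esub> \<B> =
     {C \<in> obj D. \<exists>A \<in> \<A>. \<exists>B \<in> \<B>. \<exists>f g h. dist_triangle D A C B f g h}"

definition iso_closed :: "('o, 'm, 'e) category_scheme \<Rightarrow> 'o set \<Rightarrow> bool" where
  "iso_closed D \<A> \<longleftrightarrow> (\<forall>A \<in> \<A>. \<forall>B \<in> obj D. (\<exists>f. is_iso D A B f) \<longrightarrow> B \<in> \<A>)"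

definition hom_vanishes ::
  "('o, 'm, 'e) preadditive_category_scheme \<Rightarrow> 'o set \<Rightarrow> 'o set \<Rightarrow> bool" where
  "hom_vanishes D \<A> \<B> \<longleftrightarrow> (\<forall>A \<in> \<A>. \<forall>B \<in> \<B>. Hom D A B = {hom_zero D A B})"

subsection \<open>\<open>s\<close>-torsion pairs and \<open>t\<close>-structures\<close>

text \<open>
  Used for full extension-closed subcategories \<open>\<X>\<close> (closed under isomorphisms in \<open>D\<close>),
  such as the heart and the extended heart of a \<open>t\<close>-structure.
\<close>

definition stors :: "('o, 'm, 'e) triangulated_category_scheme \<Rightarrow> 'o set \<Rightarrow> ('o set \<times> 'o set) set"
  where
  "stors D \<X> = {(\<T>, \<F>). \<T> \<subseteq> \<X> \<and> \<F> \<subseteq> \<X> \<and> iso_closed D \<T> \<and> iso_closed D \<F> \<and>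
     hom_vanishes D \<T> \<F> \<and> hom_vanishes D \<T> (unshift_class D \<F>) \<and> \<X> = \<T> \<star>\<^bsub>D\<^esub> \<F>}"

definition t_structure ::
  "('o, 'm, 'e) triangulated_category_scheme \<Rightarrow> 'o set \<times> 'o set \<Rightarrow> bool" where
  "t_structure D = (\<lambda>(\<U>, \<W>). \<U> \<subseteq> obj D \<and> \<W> \<subseteq> obj D \<and> iso_closed D \<U> \<and> iso_closed D \<W> \<and>
     shift_class D \<U> \<subseteq> \<U> \<and> hom_vanishes D \<U> (unshift_class D \<W>) \<and>
     obj D = \<U> \<star>\<^bsub>D\<^esub> unshift_class D \<W>)"

definition heart :: "('o, 'm, 'e) triangulated_category_scheme \<Rightarrow> 'o set \<times> 'o set \<Rightarrow> 'o set" where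
  "heart D = (\<lambda>(\<U>, \<W>). \<U> \<inter> \<W>)"

definition extended_heart ::
  "('o, 'm, 'e) triangulated_category_scheme \<Rightarrow> 'o set \<times> 'o set \<Rightarrow> 'o set" where
  "extended_heart D = (\<lambda>(\<U>, \<W>). \<W> \<inter> unshift_class D \<U>)"

definition T_class :: "('o, 'm, 'e) triangulated_category_scheme \<Rightarrow> 'o set \<times> 'o set
    \<Rightarrow> ('o set \<times> 'o set) set" where
  "T_class D = (\<lambda>(\<U>, \<W>). {(\<U>', \<W>'). t_structure D (\<U>', \<W>') \<and>
     shift_class D \<U> \<subseteq> \<U>' \<and> \<U>' \<subseteq> unshift_class D \<U>})"

definition T_class_plus :: "('o, 'm, 'e) triangulated_category_scheme \<Rightarrow> 'o set \<times> 'o set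
    \<Rightarrow> ('o set \<times> 'o set) set" where
  "T_class_plus D = (\<lambda>(\<U>, \<W>). {(\<U>', \<W>') \<in> T_class D (\<U>, \<W>). \<U>' \<subseteq> \<U>})"

definition stors_ext_plus :: "('o, 'm, 'e) triangulated_category_scheme \<Rightarrow> 'o set \<times> 'o set
    \<Rightarrow> ('o set \<times> 'o set) set" where
  "stors_ext_plus D u = {(\<X>, \<Y>) \<in> stors D (extended_heart D u). \<X> \<subseteq> heart D u}"

text \<open>Isomorphisms of posets between sets of pairs ordered by inclusion of first components.\<close>

definition poset_iso :: "('a set \<times> 'b set) set \<Rightarrow> ('a set \<times> 'b set) set
    \<Rightarrow> ('a set \<times> 'b set \<Rightarrow> 'a set \<times> 'b set) \<Rightarrow> bool" where
  "poset_iso P Q \<phi> \<longleftrightarrow> bij_betw \<phi> P Q \<and>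
     (\<forall>p \<in> P. \<forall>q \<in> P. fst p \<subseteq> fst q \<longleftrightarrow> fst (\<phi> p) \<subseteq> fst (\<phi> q))"

subsection \<open>Tilts\<close>

definition extended_tilt :: "('o, 'm, 'e) triangulated_category_scheme \<Rightarrow> 'o set \<times> 'o set
    \<Rightarrow> 'o set \<times> 'o set \<Rightarrow> 'o set \<times> 'o set" where
  "extended_tilt D = (\<lambda>(\<U>, \<W>) (\<X>, \<Y>).
     (shift_class D \<U> \<star>\<^bsub>D\<^esub> \<X>, shift_class D \<Y> \<star>\<^bsub>D\<^esub> unshift_class D \<W>))"

definition extended_tilt_plus :: "('o, 'm, 'e) triangulated_category_scheme \<Rightarrow> 'o set \<times> 'o set
    \<Rightarrow> 'o set \<times> 'o set \<Rightarrow> 'o set \<times> 'o set" where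
  "extended_tilt_plus D u = restrict (extended_tilt D u) (stors_ext_plus D u)"

definition right_HRS_tilt :: "('o, 'm, 'e) triangulated_category_scheme \<Rightarrow> 'o set \<times> 'o set
    \<Rightarrow> 'o set \<times> 'o set \<Rightarrow> 'o set \<times> 'o set" where
  "right_HRS_tilt D = (\<lambda>(\<U>, \<W>) (\<T>, \<F>).
     (shift_class D \<U> \<star>\<^bsub>D\<^esub> \<T>, shift_class D \<F> \<star>\<^bsub>D\<^esub> \<W>))"

definition mu_plus :: "('o, 'm, 'e) triangulated_category_scheme \<Rightarrow> 'o set \<times> 'o set
    \<Rightarrow> 'o set \<times> 'o set \<Rightarrow> 'o set \<times> 'o set" where
  "mu_plus D u = (\<lambda>(\<T>, \<F>). (\<T>, \<F> \<star>\<^bsub>D\<^esub> unshift_class D (heart D u)))"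

definition lambda_plus :: "('o, 'm, 'e) triangulated_category_scheme \<Rightarrow> 'o set \<times> 'o set
    \<Rightarrow> 'o set \<times> 'o set \<Rightarrow> 'o set \<times> 'o set" where
  "lambda_plus D u = (\<lambda>(\<X>, \<Y>). (\<X>, \<Y> \<inter> heart D u))"

end

theory Submission
  imports Defs
begin

text \<open>
  Writing \<open>\<V> = \<Sigma>\<^sup>-\<^sup>1 \<W>\<close>, \<open>t\<close>-structures are the \<open>s\<close>-torsion pairs \<open>(\<U>, \<V>)\<close> in the whole
  category. If \<open>(\<U>\<^sub>1, \<V>\<^sub>1)\<close> and \<open>(\<U>\<^sub>2, \<V>\<^sub>2)\<close> are two of them with \<open>\<U>\<^sub>1 \<subseteq> \<U>\<^sub>2\<close>, then gluing
  \<open>(\<T>, \<F>) \<mapsto> (\<U>\<^sub>1 \<star> \<T>, \<F> \<star> \<V>\<^sub>2)\<close> is a bijection from the \<open>s\<close>-torsion pairs in \<open>\<U>\<^sub>2 \<inter> \<V>\<^sub>1\<close> to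
  the interval between them, with inverse \<open>(\<U>, \<V>) \<mapsto> (\<U> \<inter> \<V>\<^sub>1, \<U>\<^sub>2 \<inter> \<V>)\<close>. The extended tilt
  is the gluing map for the interval from \<open>\<Sigma>\<U>\<close> to \<open>\<Sigma>\<^sup>-\<^sup>1 \<U>\<close>, and the right HRS-tilt the one for
  the interval from \<open>\<Sigma>\<U>\<close> to \<open>\<U>\<close>; the maps \<open>\<mu>\<^sup>+\<close> and \<open>\<lambda>\<^sup>+\<close> are obtained by composing one
  gluing map with the inverse of the other.
\<close>

subsection \<open>Morphisms in preadditive categories\<close>

context preadditive_category
begin

abbreviation hom_neg :: "'o \<Rightarrow> 'o \<Rightarrow> 'm \<Rightarrow> 'm" where
  "hom_neg A B f \<equiv> m_inv (hom_group D A B) f"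

lemma Hom_objD: "f \<in> Hom D A B \<Longrightarrow> A \<in> obj D \<and> B \<in> obj D"
  using src_in_obj tgt_in_obj by (auto simp: Hom_def)

lemma hom_zero_in_Hom: "\<lbrakk>A \<in> obj D; B \<in> obj D\<rbrakk> \<Longrightarrow> hom_zero D A B \<in> Hom D A B"
  using monoid.one_closed[OF comm_monoid.axioms(1)[OF comm_group.axioms(1)[OF hom_comm_group]]]
  by (simp add: hom_group_def)

lemma hom_add_idem_zero:
  assumes "f \<in> Hom D A B" "f \<oplus>\<^sub>h f = f"
  shows "f = hom_zero D A B"
proof -
  interpret G: comm_group "hom_group D A B" using hom_comm_group Hom_objD assms(1) by blast
  have "f \<in> carrier (hom_group D A B)" "f \<otimes>\<^bsub>hom_group D A B\<^esub> f = f"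
    using assms by (auto simp: hom_group_def)
  then have "f = \<one>\<^bsub>hom_group D A B\<^esub>" using G.l_cancel_one by blast
  then show ?thesis by (simp add: hom_group_def)
qed

lemma zero_add_zero:
  assumes "A \<in> obj D" "B \<in> obj D"
  shows "hom_zero D A B \<oplus>\<^sub>h hom_zero D A B = hom_zero D A B"
proof -
  interpret G: comm_group "hom_group D A B" using hom_comm_group assms by blast
  show ?thesis using G.l_one[OF G.one_closed] by (simp add: hom_group_def)
qed

lemma comp_zero_left:
  assumes "f \<in> Hom D A B" "C \<in> obj D"
  shows "hom_zero D B C \<cdot> f = hom_zero D A C"
proof -
  have z: "hom_zero D B C \<in> Hom D B C" using assms Hom_objD hom_zero_in_Hom by blast
  have "hom_zero D B C \<cdot> f \<oplus>\<^sub>h hom_zero D B C \<cdot> f = hom_zero D B C \<cdot> f"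
    using comp_add_left[OF assms(1) z z] zero_add_zero Hom_objD[OF z] by simp
  then show ?thesis using hom_add_idem_zero comp_in_Hom[OF assms(1) z] by blast
qed

lemma comp_zero_right:
  assumes "f \<in> Hom D A B" "C \<in> obj D"
  shows "f \<cdot> hom_zero D C A = hom_zero D C B"
proof -
  have z: "hom_zero D C A \<in> Hom D C A" using assms Hom_objD hom_zero_in_Hom by blast
  have "f \<cdot> hom_zero D C A \<oplus>\<^sub>h f \<cdot> hom_zero D C A = f \<cdot> hom_zero D C A"
    using comp_add_right[OF z z assms(1)] zero_add_zero Hom_objD[OF z] by simp
  then show ?thesis using hom_add_idem_zero comp_in_Hom[OF z assms(1)] by blast
qed

lemma hom_neg_in_Hom: "f \<in> Hom D A B \<Longrightarrow> hom_neg A B f \<in> Hom D A B"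
proof -
  assume f: "f \<in> Hom D A B"
  interpret G: comm_group "hom_group D A B" using hom_comm_group Hom_objD f by blast
  show ?thesis using G.inv_closed[of f] f by (simp add: hom_group_def)
qed

lemma hom_neg_add: "f \<in> Hom D A B \<Longrightarrow> hom_neg A B f \<oplus>\<^sub>h f = hom_zero D A B"
proof -
  assume f: "f \<in> Hom D A B"
  interpret G: comm_group "hom_group D A B" using hom_comm_group Hom_objD f by blast
  show ?thesis using G.l_inv[of f] f by (simp add: hom_group_def)
qed

lemma hom_neg_unique:
  assumes "f \<in> Hom D A B" "g \<in> Hom D A B" "g \<oplus>\<^sub>h f = hom_zero D A B"
  shows "g = hom_neg A B f"
proof -
  interpret G: comm_group "hom_group D A B" using hom_comm_group Hom_objD assms(1) by blast
  show ?thesis using G.inv_equality[of g f] assms by (simp add: hom_group_def)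
qed

lemma hom_neg_neg: "f \<in> Hom D A B \<Longrightarrow> hom_neg A B (hom_neg A B f) = f"
proof -
  assume f: "f \<in> Hom D A B"
  interpret G: comm_group "hom_group D A B" using hom_comm_group Hom_objD f by blast
  show ?thesis using G.inv_inv[of f] f by (simp add: hom_group_def)
qed

lemma comp_neg_left:
  assumes f: "f \<in> Hom D A B" and g: "g \<in> Hom D B C"
  shows "hom_neg B C g \<cdot> f = hom_neg A C (g \<cdot> f)"
  using comp_add_left[OF f hom_neg_in_Hom[OF g] g] hom_neg_add[OF g] comp_zero_left[OF f]
    Hom_objD[OF g] hom_neg_unique comp_in_Hom[OF f g] comp_in_Hom[OF f hom_neg_in_Hom[OF g]]
  by metis

lemma comp_neg_right:
  assumes f: "f \<in> Hom D A B" and g: "g \<in> Hom D B C"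
  shows "g \<cdot> hom_neg A B f = hom_neg A C (g \<cdot> f)"
  using comp_add_right[OF hom_neg_in_Hom[OF f] f g] hom_neg_add[OF f] comp_zero_right[OF g]
    Hom_objD[OF f] hom_neg_unique comp_in_Hom[OF f g] comp_in_Hom[OF hom_neg_in_Hom[OF f] g]
  by metis

text \<open>If the identity of \<open>Z\<close> vanishes, every map into or out of \<open>Z\<close>
  factors through zero. As an equation, being a zero object can be moved along the shift and derived
  from exactness.\<close>

lemma zero_object_iff_ident_zero:
  "is_zero_object D Z \<longleftrightarrow> Z \<in> obj D \<and> ident D Z = hom_zero D Z Z"
proof
  assume "is_zero_object D Z"
  then show "Z \<in> obj D \<and> ident D Z = hom_zero D Z Z"
    unfolding is_zero_object_def using ident_in_Hom hom_zero_in_Hom by blast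
next
  assume Z: "Z \<in> obj D \<and> ident D Z = hom_zero D Z Z"
  have "f = hom_zero D A Z" if "f \<in> Hom D A Z" "A \<in> obj D" for f A
    using comp_ident_left[OF that(1)] comp_zero_left[OF that(1)] Z by metis
  moreover have "f = hom_zero D Z A" if "f \<in> Hom D Z A" "A \<in> obj D" for f A
    using comp_ident_right[OF that(1)] comp_zero_right[OF that(1)] Z by metis
  ultimately show "is_zero_object D Z"
    unfolding is_zero_object_def using Z hom_zero_in_Hom by meson
qed

lemma zero_object_to:
  "\<lbrakk>is_zero_object D Z; f \<in> Hom D A Z\<rbrakk> \<Longrightarrow> f = hom_zero D A Z"
  unfolding is_zero_object_def using Hom_objD hom_zero_in_Hom by metis

lemma zero_object_from:
  "\<lbrakk>is_zero_object D Z; f \<in> Hom D Z A\<rbrakk> \<Longrightarrow> f = hom_zero D Z A"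
  unfolding is_zero_object_def using Hom_objD hom_zero_in_Hom by metis

section \<open>Isomorphisms and vanishing of Hom between classes\<close>

lemma is_iso_sym:
  assumes "is_iso D A B f"
  obtains g where "is_iso D B A g"
  using assms unfolding is_iso_def by blast

lemma is_iso_ident: "A \<in> obj D \<Longrightarrow> is_iso D A A (ident D A)"
  unfolding is_iso_def using ident_in_Hom comp_ident_left by blast

text \<open>A left and a right inverse always agree. Covariant and contravariant exactness produce
  them separately.\<close>

lemma is_isoI_left_right:
  assumes f: "f \<in> Hom D A B" and g: "g \<in> Hom D B A" "g \<cdot> f = ident D A"
    and h: "h \<in> Hom D B A" "f \<cdot> h = ident D B"
  shows "is_iso D A B f"
proof -
  have "g = g \<cdot> (f \<cdot> h)" using h(2) comp_ident_right[OF g(1)] by simp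
  also have "\<dots> = h" using comp_assoc[OF h(1) f g(1)] g(2) comp_ident_left[OF h(1)] by simp
  finally show ?thesis unfolding is_iso_def using f g h by blast
qed

lemma hom_vanishes_iff:
  assumes "\<A> \<subseteq> obj D" "\<B> \<subseteq> obj D"
  shows "hom_vanishes D \<A> \<B> \<longleftrightarrow>
    (\<forall>A \<in> \<A>. \<forall>B \<in> \<B>. \<forall>f \<in> Hom D A B. f = hom_zero D A B)"
proof -
  have "hom_zero D A B \<in> Hom D A B" if "A \<in> \<A>" "B \<in> \<B>" for A B
    using that assms hom_zero_in_Hom by blast
  then show ?thesis unfolding hom_vanishes_def by blast
qed

lemma hom_vanishes_mono:
  "\<lbrakk>hom_vanishes D \<A> \<B>; \<A>' \<subseteq> \<A>; \<B>' \<subseteq> \<B>\<rbrakk> \<Longrightarrow> hom_vanishes D \<A>' \<B>'"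
  unfolding hom_vanishes_def by blast

lemma iso_closed_Int: "\<lbrakk>iso_closed D \<A>; iso_closed D \<B>\<rbrakk> \<Longrightarrow> iso_closed D (\<A> \<inter> \<B>)"
  unfolding iso_closed_def by blast

end

subsection \<open>The shift\<close>

context triangulated_category
begin

text \<open>Only objects get an inverse of the shift; for morphisms, \<open>shift_arr_inj\<close>
  and \<open>shift_arr_surj\<close> take its place.\<close>

definition unshift :: "'o \<Rightarrow> 'o" where
  "unshift = inv_into (obj D) (shift D)"

lemma unshift_class_eq: "unshift_class D \<A> = unshift ` \<A>"
  by (simp add: unshift_class_def unshift_def)

lemma shift_in_obj: "A \<in> obj D \<Longrightarrow> shift D A \<in> obj D"
  using shift_bij bij_betwE by blast

lemma unshift_in_obj: "A \<in> obj D \<Longrightarrow> unshift A \<in> obj D"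
  unfolding unshift_def using bij_betw_inv_into[OF shift_bij] bij_betwE by blast

lemma shift_unshift: "A \<in> obj D \<Longrightarrow> shift D (unshift A) = A"
  unfolding unshift_def using bij_betw_inv_into_right[OF shift_bij] .

lemma unshift_shift: "A \<in> obj D \<Longrightarrow> unshift (shift D A) = A"
  unfolding unshift_def using bij_betw_inv_into_left[OF shift_bij] .

lemma shift_class_subset_obj: "\<A> \<subseteq> obj D \<Longrightarrow> shift_class D \<A> \<subseteq> obj D"
  using shift_in_obj by (auto simp: shift_class_def)

lemma unshift_class_subset_obj: "\<A> \<subseteq> obj D \<Longrightarrow> unshift_class D \<A> \<subseteq> obj D"
  using unshift_in_obj by (auto simp: unshift_class_eq)

lemma shift_unshift_class: "\<A> \<subseteq> obj D \<Longrightarrow> shift_class D (unshift_class D \<A>) = \<A>"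
  by (force simp: shift_class_def unshift_class_eq shift_unshift image_image subset_iff)

lemma unshift_shift_class: "\<A> \<subseteq> obj D \<Longrightarrow> unshift_class D (shift_class D \<A>) = \<A>"
  by (force simp: shift_class_def unshift_class_eq unshift_shift image_image subset_iff)

lemma unshift_class_mono: "\<A> \<subseteq> \<B> \<Longrightarrow> unshift_class D \<A> \<subseteq> unshift_class D \<B>"
  by (auto simp: unshift_class_eq)

lemma unshift_class_Int:
  "\<lbrakk>\<A> \<subseteq> obj D; \<B> \<subseteq> obj D\<rbrakk>
    \<Longrightarrow> unshift_class D (\<A> \<inter> \<B>) = unshift_class D \<A> \<inter> unshift_class D \<B>"
  unfolding unshift_class_eq
  by (rule inj_on_image_Int[OF inj_on_inverseI[of _ "shift D"]]) (auto simp: shift_unshift)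

lemma shift_arr_zero:
  assumes "A \<in> obj D" "B \<in> obj D"
  shows "shift_arr D (hom_zero D A B) = hom_zero D (shift D A) (shift D B)"
  using shift_add[of "hom_zero D A B" A B "hom_zero D A B"] hom_add_idem_zero shift_arr_in_Hom
    zero_add_zero hom_zero_in_Hom assms by metis

lemma shift_arr_inj:
  "\<lbrakk>f \<in> Hom D A B; g \<in> Hom D A' B'; shift_arr D f = shift_arr D g\<rbrakk> \<Longrightarrow> f = g"
  using shift_arr_bij by (auto simp: Hom_def bij_betw_def dest: inj_onD)

text \<open>Bijectivity on all arrows only yields some preimage; its source and target are the right
  ones because the shift is injective on objects.\<close>

lemma shift_arr_surj:
  assumes "f \<in> Hom D (shift D A) (shift D B)" "A \<in> obj D" "B \<in> obj D"
  obtains g where "g \<in> Hom D A B" "shift_arr D g = f"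
proof -
  have "f \<in> shift_arr D ` arr D"
    using assms(1) shift_arr_bij by (auto simp: Hom_def bij_betw_def)
  then obtain g where g: "g \<in> arr D" "shift_arr D g = f" by blast
  then have g': "g \<in> Hom D (src D g) (tgt D g)" by (simp add: Hom_def)
  have "shift D (src D g) = shift D A" "shift D (tgt D g) = shift D B"
    using shift_arr_in_Hom[OF g'] g(2) assms(1) by (auto simp: Hom_def)
  then have "src D g = A" "tgt D g = B"
    using unshift_shift assms Hom_objD[OF g'] by metis+
  then show thesis using that g' g(2) by blast
qed

lemma zero_object_shift: "is_zero_object D Z \<Longrightarrow> is_zero_object D (shift D Z)"
  unfolding zero_object_iff_ident_zero
  using shift_ident shift_arr_zero shift_in_obj by metis

lemma zero_object_unshift:
  assumes "is_zero_object D Z" shows "is_zero_object D (unshift Z)"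
proof -
  have Z: "Z \<in> obj D" "ident D Z = hom_zero D Z Z"
    using assms zero_object_iff_ident_zero by auto
  have o: "unshift Z \<in> obj D" "shift D (unshift Z) = Z"
    using Z unshift_in_obj shift_unshift by auto
  have "shift_arr D (ident D (unshift Z)) = shift_arr D (hom_zero D (unshift Z) (unshift Z))"
    using shift_ident[OF o(1)] shift_arr_zero[OF o(1) o(1)] o Z by simp
  then show ?thesis using shift_arr_inj ident_in_Hom hom_zero_in_Hom o
    zero_object_iff_ident_zero by metis
qed

section \<open>Rotating and shifting distinguished triangles\<close>

lemma dist_triangleD:
  assumes "dist_triangle D X Y Z f g h"
  shows "f \<in> Hom D X Y" "g \<in> Hom D Y Z" "h \<in> Hom D Z (shift D X)"
    "X \<in> obj D" "Y \<in> obj D" "Z \<in> obj D"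
  using assms Hom_objD unfolding dist_triangle_def is_triangle_def by blast+

lemma rotate:
  assumes "dist_triangle D X Y Z f g h"
  shows "dist_triangle D Y Z (shift D X) g h (hom_neg (shift D X) (shift D Y) (shift_arr D f))"
  using assms dist_rotate unfolding dist_triangle_def by blast

lemma unrotate:
  assumes t: "dist_triangle D X Y Z f g h"
  obtains k where "dist_triangle D (unshift Z) X Y k f g"
proof -
  note d = dist_triangleD[OF t]
  have o: "unshift Z \<in> obj D" "shift D (unshift Z) = Z"
    using d unshift_in_obj shift_unshift by auto
  \<comment> \<open>Rotation negates the shifted first map, so \<open>k\<close> is chosen to shift
    to the negative of \<open>h\<close>.\<close>
  let ?h = "hom_neg Z (shift D X) h"
  have "?h \<in> Hom D (shift D (unshift Z)) (shift D X)" using o hom_neg_in_Hom d by simp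
  then obtain k where k: "k \<in> Hom D (unshift Z) X" "shift_arr D k = ?h"
    using shift_arr_surj o d by metis
  have "is_triangle D (unshift Z) X Y k f g" using k d o unfolding is_triangle_def by simp
  moreover have "dist_triangle D X Y Z f g (hom_neg Z (shift D X) (shift_arr D k))"
    using t k(2) hom_neg_neg[OF d(3)] by simp
  ultimately show thesis using that dist_rotate o(2) by metis
qed

text \<open>Three rotations shift all three objects. The maps acquire signs, which are irrelevant
  for membership in a class formed by \<star>.\<close>

lemma shift_triangle:
  assumes "dist_triangle D X Y Z f g h"
  shows "\<exists>f' g' h'. dist_triangle D (shift D X) (shift D Y) (shift D Z) f' g' h'"
  using rotate[OF rotate[OF rotate[OF assms]]] by blast

lemma unshift_triangle:
  assumes "dist_triangle D X Y Z f g h"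
  shows "\<exists>f' g' h'. dist_triangle D (unshift X) (unshift Y) (unshift Z) f' g' h'"
  using unrotate assms by metis

subsection \<open>Exactness of Hom\<close>

text \<open>The maps \<open>a\<close> and zero form a commuting square from
  \<open>P \<rightarrow> 0\<close> to \<open>Y \<rightarrow> Z\<close>. Completing it to a morphism
  from the rotated trivial triangle on \<open>P\<close> to the rotated \<open>t\<close> gives a map
  between shifts of \<open>P\<close> and \<open>X\<close>, which is then desuspended to
  \<open>b\<close>.\<close>

lemma exact_cov:
  assumes t: "dist_triangle D X Y Z f g h" and a: "a \<in> Hom D P Y"
    and z: "g \<cdot> a = hom_zero D P Z"
  obtains b where "b \<in> Hom D P X" "f \<cdot> b = a"
proof -
  note d = dist_triangleD[OF t]
  have P: "P \<in> obj D" using a Hom_objD by blast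
  obtain N where N: "is_zero_object D N" using ex_zero_object by blast
  then have No: "N \<in> obj D" unfolding is_zero_object_def by blast
  note s = dist_ident[OF P N]
  let ?n = "hom_neg (shift D P) (shift D P) (shift_arr D (ident D P))"
  have "hom_zero D N Z \<cdot> hom_zero D P N = g \<cdot> a"
    using z comp_zero_left[OF hom_zero_in_Hom[OF P No]] d by simp
  then obtain c where c: "c \<in> Hom D (shift D P) (shift D X)"
    "shift_arr D a \<cdot> ?n = hom_neg (shift D X) (shift D Y) (shift_arr D f) \<cdot> c"
    using dist_morphism[OF rotate[OF s] rotate[OF t] a hom_zero_in_Hom[OF No d(6)]] by blast
  obtain b where b: "b \<in> Hom D P X" "shift_arr D b = c" using shift_arr_surj c P d by metis
  have i: "ident D P \<in> Hom D P P" using ident_in_Hom P by blast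
  \<comment> \<open>Each side of the square for \<open>c\<close> is the negative of a shifted
    morphism, so the signs of the two rotations cancel.\<close>
  have "shift_arr D a \<cdot> ?n = hom_neg (shift D P) (shift D Y) (shift_arr D a)"
    using comp_neg_right shift_arr_in_Hom[OF i] shift_arr_in_Hom[OF a] shift_ident[OF P]
      comp_ident_right by metis
  moreover have "hom_neg (shift D X) (shift D Y) (shift_arr D f) \<cdot> c =
      hom_neg (shift D P) (shift D Y) (shift_arr D (f \<cdot> b))"
    using comp_neg_left[OF c(1) shift_arr_in_Hom[OF d(1)]] shift_comp[OF b(1) d(1)] b(2) by simp
  ultimately have "shift_arr D a = shift_arr D (f \<cdot> b)"
    using c(2) hom_neg_neg shift_arr_in_Hom a comp_in_Hom[OF b(1) d(1)] by metis
  then show thesis using that b(1) shift_arr_inj a comp_in_Hom[OF b(1) d(1)] by metis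
qed

lemma exact_contra:
  assumes t: "dist_triangle D X Y Z f g h" and a: "a \<in> Hom D Y Q"
    and z: "a \<cdot> f = hom_zero D X Q"
  obtains b where "b \<in> Hom D Z Q" "b \<cdot> g = a"
proof -
  note d = dist_triangleD[OF t]
  have Q: "Q \<in> obj D" using a Hom_objD by blast
  obtain N where N: "is_zero_object D N" using ex_zero_object by blast
  obtain k where s: "dist_triangle D (unshift N) Q Q k (ident D Q) (hom_zero D Q N)"
    using unrotate dist_ident[OF Q N] by blast
  note e = dist_triangleD[OF s]
  have "a \<cdot> f = k \<cdot> hom_zero D X (unshift N)"
    using z comp_zero_right[OF e(1)] d by simp
  then obtain b where "b \<in> Hom D Z Q" "b \<cdot> g = ident D Q \<cdot> a"
    using dist_morphism[OF t s hom_zero_in_Hom[OF d(4) e(4)] a] by blast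
  then show thesis using that comp_ident_left[OF a] by simp
qed

text \<open>The restriction of \<open>a\<close> to \<open>X\<close> vanishes, so \<open>a\<close>
  factors through \<open>Z\<close>, from which every map to \<open>Q\<close> vanishes.\<close>

lemma hom_zero_from_ext:
  assumes t: "dist_triangle D X Y Z f g h" and a: "a \<in> Hom D Y Q"
    and "\<forall>b \<in> Hom D X Q. b = hom_zero D X Q" "\<forall>b \<in> Hom D Z Q. b = hom_zero D Z Q"
  shows "a = hom_zero D Y Q"
proof -
  note d = dist_triangleD[OF t]
  have "a \<cdot> f = hom_zero D X Q" using comp_in_Hom[OF d(1) a] assms by blast
  then obtain b where "b \<in> Hom D Z Q" "b \<cdot> g = a" using exact_contra t a by blast
  then show ?thesis using assms(4) comp_zero_left[OF d(2)] Hom_objD a by metis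
qed

lemma hom_zero_to_ext:
  assumes t: "dist_triangle D X Y Z f g h" and a: "a \<in> Hom D P Y"
    and "\<forall>b \<in> Hom D P X. b = hom_zero D P X" "\<forall>b \<in> Hom D P Z. b = hom_zero D P Z"
  shows "a = hom_zero D P Y"
proof -
  note d = dist_triangleD[OF t]
  have "g \<cdot> a = hom_zero D P Z" using comp_in_Hom[OF a d(2)] assms by blast
  then obtain b where "b \<in> Hom D P X" "f \<cdot> b = a" using exact_cov t a by blast
  then show ?thesis using assms(3) comp_zero_right[OF d(1)] Hom_objD a by metis
qed

lemma shift_hom_zero:
  assumes "A \<in> obj D" "B \<in> obj D" "\<forall>b \<in> Hom D A (unshift B). b = hom_zero D A (unshift B)"
  shows "\<forall>b \<in> Hom D (shift D A) B. b = hom_zero D (shift D A) B"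
  using assms shift_arr_surj[of _ A "unshift B"] shift_arr_zero unshift_in_obj shift_unshift
  by metis

text \<open>Since \<open>g\<close> vanishes, the identity of \<open>Z\<close> factors as
  \<open>k\<close> after \<open>h\<close>, with \<open>k\<close> from the shift of \<open>X\<close>
  to \<open>Z\<close>. By \<open>v\<close> this \<open>k\<close> is zero, hence \<open>Z\<close> is
  zero. Then \<open>f\<close> has a right inverse because \<open>g\<close> is zero, and a left
  inverse because the map from \<open>unshift Z\<close> to \<open>X\<close> is zero.\<close>

lemma iso_if_second_zero:
  assumes t: "dist_triangle D X Y Z f g h" and g: "g = hom_zero D Y Z"
    and v: "\<forall>b \<in> Hom D X (unshift Z). b = hom_zero D X (unshift Z)"
  shows "is_iso D X Y f"
proof -
  note d = dist_triangleD[OF t]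
  have iZ: "ident D Z \<in> Hom D Z Z" and iX: "ident D X \<in> Hom D X X"
    and iY: "ident D Y \<in> Hom D Y Y" using ident_in_Hom d by auto
  have "ident D Z \<cdot> g = hom_zero D Y Z" using comp_ident_left d g by simp
  then obtain k where k: "k \<in> Hom D (shift D X) Z" "k \<cdot> h = ident D Z"
    using exact_contra[OF rotate[OF t] iZ] by blast
  have "k = hom_zero D (shift D X) Z" using shift_hom_zero v k(1) d by blast
  then have "ident D Z = hom_zero D Z Z" using k comp_zero_left[OF d(3) d(6)] by simp
  then have Z: "is_zero_object D Z" using zero_object_iff_ident_zero d by blast
  obtain h' where t': "dist_triangle D (unshift Z) X Y h' f g" using unrotate t by blast
  note d' = dist_triangleD[OF t']
  have "g \<cdot> ident D Y = hom_zero D Y Z" using comp_ident_right[OF d(2)] g by simp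
  then obtain b where b: "b \<in> Hom D Y X" "f \<cdot> b = ident D Y" using exact_cov[OF t iY] by blast
  have "ident D X \<cdot> h' = hom_zero D (unshift Z) X"
    using zero_object_from[OF zero_object_unshift[OF Z]] comp_in_Hom[OF d'(1) iX] by blast
  then obtain c where "c \<in> Hom D Y X" "c \<cdot> f = ident D X" using exact_contra[OF t' iX] by blast
  then show ?thesis using is_isoI_left_right d b by blast
qed

text \<open>Dually, the identity of \<open>X\<close> factors through \<open>unshift Z\<close> by a
  map that \<open>v\<close> kills, so \<open>X\<close> is zero; exactness on both sides then inverts
  \<open>g\<close>.\<close>

lemma iso_if_first_zero:
  assumes t: "dist_triangle D X Y Z f g h" and f: "f = hom_zero D X Y"
    and v: "\<forall>b \<in> Hom D X (unshift Z). b = hom_zero D X (unshift Z)"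
  shows "is_iso D Y Z g"
proof -
  note d = dist_triangleD[OF t]
  have iZ: "ident D Z \<in> Hom D Z Z" and iX: "ident D X \<in> Hom D X X"
    and iY: "ident D Y \<in> Hom D Y Y" using ident_in_Hom d by auto
  obtain h' where t': "dist_triangle D (unshift Z) X Y h' f g" using unrotate t by blast
  note d' = dist_triangleD[OF t']
  have "f \<cdot> ident D X = hom_zero D X Y" using comp_ident_right d f by simp
  then obtain k where k: "k \<in> Hom D X (unshift Z)" "h' \<cdot> k = ident D X"
    using exact_cov[OF t' iX] by blast
  then have "ident D X = hom_zero D X X" using v comp_zero_right[OF d'(1) d(4)] by metis
  then have X: "is_zero_object D X" using zero_object_iff_ident_zero d by blast
  have "ident D Y \<cdot> f = hom_zero D X Y" using comp_ident_left[OF d(1)] f by simp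
  then obtain b where b: "b \<in> Hom D Z Y" "b \<cdot> g = ident D Y" using exact_contra[OF t iY] by blast
  have "h \<cdot> ident D Z = hom_zero D Z (shift D X)"
    using zero_object_to[OF zero_object_shift[OF X]] comp_in_Hom[OF iZ d(3)] by blast
  then obtain c where "c \<in> Hom D Z Y" "g \<cdot> c = ident D Z"
    using exact_cov[OF rotate[OF t] iZ] by blast
  then show ?thesis using is_isoI_left_right d b by blast
qed

subsection \<open>Extensions of classes\<close>

lemma starI: "\<lbrakk>dist_triangle D A C B f g h; A \<in> \<A>; B \<in> \<B>\<rbrakk> \<Longrightarrow> C \<in> \<A> \<star> \<B>"
  unfolding star_def using dist_triangleD(5) by blast

lemma starE:
  assumes "C \<in> \<A> \<star> \<B>"
  obtains A B f g h where "A \<in> \<A>" "B \<in> \<B>" "dist_triangle D A C B f g h"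
  using assms unfolding star_def by blast

lemma star_mono: "\<lbrakk>\<A> \<subseteq> \<A>'; \<B> \<subseteq> \<B>'\<rbrakk> \<Longrightarrow> \<A> \<star> \<B> \<subseteq> \<A>' \<star> \<B>'"
  unfolding star_def by blast

lemma star_subset_obj: "\<A> \<star> \<B> \<subseteq> obj D"
  unfolding star_def by blast

text \<open>The triangle is transported along the isomorphism of its middle term with identities at
  both ends, so nothing is required of the two classes.\<close>

lemma iso_closed_star: "iso_closed D (\<A> \<star> \<B>)"
  unfolding iso_closed_def
proof (intro ballI impI)
  fix C C' assume C: "C \<in> \<A> \<star> \<B>" "C' \<in> obj D" "\<exists>c. is_iso D C C' c"
  then obtain c c' where c: "is_iso D C C' c" "c \<in> Hom D C C'" "c' \<in> Hom D C' C"
      "c' \<cdot> c = ident D C" unfolding is_iso_def by blast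
  obtain A B f g h where t: "A \<in> \<A>" "B \<in> \<B>" "dist_triangle D A C B f g h"
    using C starE by blast
  note d = dist_triangleD[OF t(3)]
  have "is_triangle D A C' B (c \<cdot> f) (g \<cdot> c') h"
    unfolding is_triangle_def using comp_in_Hom[OF d(1) c(2)] comp_in_Hom[OF c(3) d(2)] d(3) by blast
  moreover have "c \<cdot> f = (c \<cdot> f) \<cdot> ident D A"
    using comp_ident_right[OF comp_in_Hom[OF d(1) c(2)]] by simp
  moreover have "ident D B \<cdot> g = (g \<cdot> c') \<cdot> c"
    using comp_assoc[OF c(2,3) d(2)] c(4) comp_ident_right[OF d(2)] comp_ident_left[OF d(2)]
    by simp
  moreover have "shift_arr D (ident D A) \<cdot> h = h \<cdot> ident D B"
    using shift_ident[OF d(4)] comp_ident_right[OF d(3)] comp_ident_left[OF d(3)] by simp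
  ultimately have "dist_triangle D A C' B (c \<cdot> f) (g \<cdot> c') h"
    using dist_iso_closed[OF t(3) _ is_iso_ident[OF d(4)] c(1) is_iso_ident[OF d(6)]] by blast
  then show "C' \<in> \<A> \<star> \<B>" using starI t by blast
qed

text \<open>The octahedral axiom for \<open>A \<rightarrow> M \<rightarrow> N\<close> shows that the
  cone of the composite is an extension of \<open>C\<close> by \<open>B\<close>.\<close>

lemma star_assoc_subset: "(\<A> \<star> \<B>) \<star> \<C> \<subseteq> \<A> \<star> (\<B> \<star> \<C>)"
proof
  fix N assume "N \<in> (\<A> \<star> \<B>) \<star> \<C>"
  then obtain M C f g h where M: "M \<in> \<A> \<star> \<B>" and t1: "C \<in> \<C>" "dist_triangle D M N C f g h"
    by (rule starE)
  obtain A B f' g' h' where t2: "A \<in> \<A>" "B \<in> \<B>" "dist_triangle D A M B f' g' h'"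
    using M by (rule starE)
  have "f \<cdot> f' \<in> Hom D A N"
    using comp_in_Hom[OF dist_triangleD(1)[OF t2(3)] dist_triangleD(1)[OF t1(2)]] .
  then obtain Y p q where y: "dist_triangle D A N Y (f \<cdot> f') p q" using ex_dist[OF \<open>f \<cdot> f' \<in> _\<close>] by blast
  obtain v w x where o: "dist_triangle D B Y C v w x" using octahedral[OF t2(3) t1(2) y] by (elim exE conjE) (rule that)
  show "N \<in> \<A> \<star> (\<B> \<star> \<C>)"
    using starI[OF y t2(1) starI[OF o t2(2) t1(1)]] .
qed

text \<open>For the other inclusion the octahedral axiom is applied to
  \<open>N \<rightarrow> M \<rightarrow> C\<close>, using rotated triangles. The cone
  \<open>Y\<close> of the composite sits between the shifts of \<open>A\<close> and
  \<open>B\<close>, so \<open>unshift Y\<close> lies in the extensions of \<open>B\<close> by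
  \<open>A\<close> and is the first term of a triangle over
  \<open>N \<rightarrow> C\<close>.\<close>

lemma star_assoc:
  "(\<A> \<star> \<B>) \<star> \<C> = \<A> \<star> (\<B> \<star> \<C>)"
proof (rule equalityI[OF star_assoc_subset], rule subsetI)
  fix N assume "N \<in> \<A> \<star> (\<B> \<star> \<C>)"
  then obtain A M f g h where M: "M \<in> \<B> \<star> \<C>" and t1: "A \<in> \<A>" "dist_triangle D A N M f g h"
    by (rule starE)
  obtain B C f' g' h' where t2: "B \<in> \<B>" "C \<in> \<C>" "dist_triangle D B M C f' g' h'"
    using M by (rule starE)
  have "g' \<cdot> g \<in> Hom D N C"
    using comp_in_Hom[OF dist_triangleD(2)[OF t1(2)] dist_triangleD(2)[OF t2(3)]] .
  then obtain Y p q where y: "dist_triangle D N C Y (g' \<cdot> g) p q" using ex_dist[OF \<open>g' \<cdot> g \<in> _\<close>] by blast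
  obtain v w x where "dist_triangle D (shift D A) Y (shift D B) v w x"
    using octahedral[OF rotate[OF t1(2)] rotate[OF t2(3)] y] by (elim exE conjE) (rule that)
  from unshift_triangle[OF this] obtain v w x where "dist_triangle D A (unshift Y) B v w x"
    unfolding unshift_shift[OF dist_triangleD(4)[OF t1(2)]]
      unshift_shift[OF dist_triangleD(4)[OF t2(3)]] by blast
  then have Y: "unshift Y \<in> \<A> \<star> \<B>" using starI[OF _ t1(1) t2(1)] by blast
  obtain k where k: "dist_triangle D (unshift Y) N C k (g' \<cdot> g) p"
    using unrotate[OF y] .
  show "N \<in> (\<A> \<star> \<B>) \<star> \<C>" using starI[OF k Y t2(2)] .
qed

lemma shift_class_star:
  assumes "\<A> \<subseteq> obj D" "\<B> \<subseteq> obj D"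
  shows "shift_class D (\<A> \<star> \<B>) = shift_class D \<A> \<star> shift_class D \<B>"
proof
  show "shift_class D (\<A> \<star> \<B>) \<subseteq> shift_class D \<A> \<star> shift_class D \<B>"
  proof
    fix C assume "C \<in> shift_class D (\<A> \<star> \<B>)"
    then obtain M where M: "M \<in> \<A> \<star> \<B>" "C = shift D M" unfolding shift_class_def by blast
    obtain A B f g h where t: "A \<in> \<A>" "B \<in> \<B>" "dist_triangle D A M B f g h"
      using M(1) by (rule starE)
    obtain f' g' h' where "dist_triangle D (shift D A) C (shift D B) f' g' h'"
      using shift_triangle[OF t(3)] M(2) by blast
    then show "C \<in> shift_class D \<A> \<star> shift_class D \<B>"
      using starI[of "shift D A" C "shift D B"] t(1,2) unfolding shift_class_def by blast
  qed
  show "shift_class D \<A> \<star> shift_class D \<B> \<subseteq> shift_class D (\<A> \<star> \<B>)"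
  proof
    fix C assume "C \<in> shift_class D \<A> \<star> shift_class D \<B>"
    then obtain A B f g h where t: "A \<in> \<A>" "B \<in> \<B>"
        "dist_triangle D (shift D A) C (shift D B) f g h"
      unfolding shift_class_def by (auto elim!: starE)
    have o: "A \<in> obj D" "B \<in> obj D" using t(1,2) assms by auto
    have "unshift C \<in> \<A> \<star> \<B>"
      using unshift_triangle[OF t(3)] starI[OF _ t(1,2)]
      unfolding unshift_shift[OF o(1)] unshift_shift[OF o(2)] by blast
    moreover have "C = shift D (unshift C)" using shift_unshift dist_triangleD(5)[OF t(3)] by simp
    ultimately show "C \<in> shift_class D (\<A> \<star> \<B>)" unfolding shift_class_def by blast
  qed
qed

lemma unshift_class_star:
  assumes "\<A> \<subseteq> obj D" "\<B> \<subseteq> obj D"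
  shows "unshift_class D (\<A> \<star> \<B>) = unshift_class D \<A> \<star> unshift_class D \<B>"
  using shift_class_star[of "unshift_class D \<A>" "unshift_class D \<B>"] shift_unshift_class
    unshift_shift_class unshift_class_subset_obj assms star_subset_obj by metis

lemma subset_star_left:
  assumes "\<A> \<subseteq> obj D" "is_zero_object D Z" "Z \<in> \<B>"
  shows "\<A> \<subseteq> \<A> \<star> \<B>"
  using dist_ident assms starI by blast

text \<open>The triangle with zero first term comes from unrotating
  \<open>B \<rightarrow> B \<rightarrow> Z\<close>. Its first term is literally
  \<open>unshift Z\<close>, which is why that object appears in the hypothesis.\<close>

lemma subset_star_right:
  assumes "\<B> \<subseteq> obj D" "is_zero_object D Z" "unshift Z \<in> \<A>"
  shows "\<B> \<subseteq> \<A> \<star> \<B>"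
proof
  fix B assume B: "B \<in> \<B>"
  obtain k where "dist_triangle D (unshift Z) B B k (ident D B) (hom_zero D B Z)"
    using unrotate dist_ident B assms(1,2) by blast
  then show "B \<in> \<A> \<star> \<B>" using starI assms(3) B by blast
qed

lemma hom_vanishes_star_left:
  assumes "\<C> \<subseteq> obj D" "hom_vanishes D \<A> \<C>" "hom_vanishes D \<B> \<C>"
  shows "hom_vanishes D (\<A> \<star> \<B>) \<C>"
  unfolding hom_vanishes_iff[OF star_subset_obj assms(1)]
proof (intro ballI)
  fix M C f assume "M \<in> \<A> \<star> \<B>" and f: "C \<in> \<C>" "f \<in> Hom D M C"
  then obtain A B p q r where t: "A \<in> \<A>" "B \<in> \<B>" "dist_triangle D A M B p q r"
    using starE by blast
  then show "f = hom_zero D M C"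
    using hom_zero_from_ext[OF t(3) f(2)] assms(2,3) f(1) unfolding hom_vanishes_def by blast
qed

lemma hom_vanishes_star_right:
  assumes "\<C> \<subseteq> obj D" "hom_vanishes D \<C> \<A>" "hom_vanishes D \<C> \<B>"
  shows "hom_vanishes D \<C> (\<A> \<star> \<B>)"
  unfolding hom_vanishes_iff[OF assms(1) star_subset_obj]
proof (intro ballI)
  fix C M f assume "M \<in> \<A> \<star> \<B>" and f: "C \<in> \<C>" "f \<in> Hom D C M"
  then obtain A B p q r where t: "A \<in> \<A>" "B \<in> \<B>" "dist_triangle D A M B p q r"
    using starE by blast
  then show "f = hom_zero D C M"
    using hom_zero_to_ext[OF t(3) f(2)] assms(2,3) f(1) unfolding hom_vanishes_def by blast
qed

text \<open>The shift identifies maps from the shift of \<open>A\<close> to \<open>B\<close> with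
  maps from \<open>A\<close> to \<open>unshift B\<close>. This lets the second vanishing condition
  of an s-torsion pair be read as closure under the shift.\<close>

lemma hom_vanishes_shift:
  assumes "\<A> \<subseteq> obj D" "\<B> \<subseteq> obj D"
  shows "hom_vanishes D (shift_class D \<A>) \<B> \<longleftrightarrow> hom_vanishes D \<A> (unshift_class D \<B>)"
proof
  assume h: "hom_vanishes D \<A> (unshift_class D \<B>)"
  show "hom_vanishes D (shift_class D \<A>) \<B>"
    unfolding hom_vanishes_iff[OF shift_class_subset_obj[OF assms(1)] assms(2)]
  proof (intro ballI)
    fix A' B f assume "A' \<in> shift_class D \<A>" and B: "B \<in> \<B>" "f \<in> Hom D A' B"
    then obtain A where A: "A \<in> \<A>" "A' = shift D A" unfolding shift_class_def by blast
    have "\<forall>b \<in> Hom D A (unshift B). b = hom_zero D A (unshift B)"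
      using h A(1) B(1) unfolding hom_vanishes_def unshift_class_eq by blast
    then show "f = hom_zero D A' B"
      using shift_hom_zero[of A B] A B assms by blast
  qed
next
  assume h: "hom_vanishes D (shift_class D \<A>) \<B>"
  show "hom_vanishes D \<A> (unshift_class D \<B>)"
    unfolding hom_vanishes_iff[OF assms(1) unshift_class_subset_obj[OF assms(2)]]
  proof (intro ballI)
    fix A B' f assume A: "A \<in> \<A>" "f \<in> Hom D A B'" and "B' \<in> unshift_class D \<B>"
    then obtain B where B: "B \<in> \<B>" "B' = unshift B" unfolding unshift_class_eq by blast
    have o: "A \<in> obj D" "B \<in> obj D" "B' \<in> obj D" "shift D B' = B"
      using A B assms shift_unshift unshift_in_obj by auto
    have "shift_arr D f \<in> Hom D (shift D A) B"
      using shift_arr_in_Hom[OF A(2)] o(4) by simp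
    moreover have "Hom D (shift D A) B = {hom_zero D (shift D A) B}"
      using h A(1) B(1) unfolding hom_vanishes_def shift_class_def by blast
    ultimately have "shift_arr D f = shift_arr D (hom_zero D A B')"
      using shift_arr_zero[OF o(1,3)] o(4) by simp
    then show "f = hom_zero D A B'"
      using shift_arr_inj[OF A(2) hom_zero_in_Hom[OF o(1,3)]] by simp
  qed
qed

section \<open>Closure under isomorphism of shifted classes\<close>

lemma is_iso_shift:
  assumes "is_iso D A B f" shows "is_iso D (shift D A) (shift D B) (shift_arr D f)"
proof -
  obtain g where g: "f \<in> Hom D A B" "g \<in> Hom D B A" "g \<cdot> f = ident D A" "f \<cdot> g = ident D B"
    using assms unfolding is_iso_def by blast
  have "shift_arr D g \<cdot> shift_arr D f = ident D (shift D A)"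
    "shift_arr D f \<cdot> shift_arr D g = ident D (shift D B)"
    using shift_comp[OF g(1,2)] shift_comp[OF g(2,1)] g(3,4) shift_ident Hom_objD[OF g(1)] by auto
  then show ?thesis unfolding is_iso_def using g(1,2) shift_arr_in_Hom by blast
qed

lemma is_iso_unshift:
  assumes "is_iso D (shift D A) (shift D B) f" and o: "A \<in> obj D" "B \<in> obj D"
  obtains g where "is_iso D A B g"
proof -
  obtain f' where f: "f \<in> Hom D (shift D A) (shift D B)" "f' \<in> Hom D (shift D B) (shift D A)"
    "f' \<cdot> f = ident D (shift D A)" "f \<cdot> f' = ident D (shift D B)"
    using assms unfolding is_iso_def by blast
  obtain g where g: "g \<in> Hom D A B" "shift_arr D g = f" using shift_arr_surj[OF f(1) o] .
  obtain g' where g': "g' \<in> Hom D B A" "shift_arr D g' = f'"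
    using shift_arr_surj[OF f(2) o(2,1)] .
  have "shift_arr D (g' \<cdot> g) = shift_arr D (ident D A)"
    using shift_comp[OF g(1) g'(1)] g(2) g'(2) f(3) shift_ident[OF o(1)] by simp
  then have 1: "g' \<cdot> g = ident D A"
    using shift_arr_inj[OF comp_in_Hom[OF g(1) g'(1)] ident_in_Hom[OF o(1)]] by simp
  have "shift_arr D (g \<cdot> g') = shift_arr D (ident D B)"
    using shift_comp[OF g'(1) g(1)] g(2) g'(2) f(4) shift_ident[OF o(2)] by simp
  then have "g \<cdot> g' = ident D B"
    using shift_arr_inj[OF comp_in_Hom[OF g'(1) g(1)] ident_in_Hom[OF o(2)]] by simp
  then show thesis using that g(1) g'(1) 1 unfolding is_iso_def by blast
qed

lemma iso_closed_shift_class: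
  assumes "\<A> \<subseteq> obj D" "iso_closed D \<A>"
  shows "iso_closed D (shift_class D \<A>)"
  unfolding iso_closed_def
proof (intro ballI impI)
  fix A B assume "A \<in> shift_class D \<A>" and B: "B \<in> obj D" "\<exists>f. is_iso D A B f"
  then obtain A' where A: "A' \<in> \<A>" "A = shift D A'" unfolding shift_class_def by blast
  obtain f where "is_iso D (shift D A') (shift D (unshift B)) f"
    using B A(2) shift_unshift[OF B(1)] by auto
  then obtain g where "is_iso D A' (unshift B) g"
    using is_iso_unshift A(1) assms(1) unshift_in_obj[OF B(1)] by blast
  then have "unshift B \<in> \<A>"
    using A(1) assms(2) unshift_in_obj[OF B(1)] unfolding iso_closed_def by blast
  then show "B \<in> shift_class D \<A>"
    using shift_unshift[OF B(1)] unfolding shift_class_def by force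
qed

lemma iso_closed_unshift_class:
  assumes "\<A> \<subseteq> obj D" "iso_closed D \<A>"
  shows "iso_closed D (unshift_class D \<A>)"
  unfolding iso_closed_def
proof (intro ballI impI)
  fix A B assume "A \<in> unshift_class D \<A>" and B: "B \<in> obj D" "\<exists>f. is_iso D A B f"
  then obtain A' where A: "A' \<in> \<A>" "A = unshift A'" unfolding unshift_class_eq by blast
  then have "shift D A = A'" using shift_unshift assms(1) by auto
  then obtain g where "is_iso D A' (shift D B) g" using is_iso_shift B(2) by metis
  then have "shift D B \<in> \<A>"
    using A(1) assms(2) shift_in_obj[OF B(1)] unfolding iso_closed_def by blast
  then show "B \<in> unshift_class D \<A>"
    using unshift_shift[OF B(1)] unfolding unshift_class_eq by force
qed

subsection \<open>\<open>s\<close>-torsion pairs\<close>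

lemma storsD:
  assumes "(\<T>, \<F>) \<in> stors D \<X>"
  shows "\<T> \<subseteq> \<X>" "\<F> \<subseteq> \<X>" "iso_closed D \<T>" "iso_closed D \<F>" "hom_vanishes D \<T> \<F>"
    "hom_vanishes D \<T> (unshift_class D \<F>)" "\<X> = \<T> \<star> \<F>"
  using assms unfolding stors_def by auto

lemma storsI:
  assumes "\<T> \<subseteq> \<X>" "\<F> \<subseteq> \<X>" "iso_closed D \<T>" "iso_closed D \<F>" "hom_vanishes D \<T> \<F>"
    "hom_vanishes D \<T> (unshift_class D \<F>)" "\<X> = \<T> \<star> \<F>"
  shows "(\<T>, \<F>) \<in> stors D \<X>"
  using assms unfolding stors_def by auto

text \<open>In the triangle \<open>A \<rightarrow> C \<rightarrow> B\<close> of \<open>C\<close>, the map \<open>C \<rightarrow> B\<close> vanishes, so \<open>\<Sigma>\<^sup>-\<^sup>1 B\<close> is a direct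
  summand of \<open>A\<close>; the second vanishing condition forces \<open>B = 0\<close>. Hence no closure under direct
  summands has to be assumed. Dually for \<open>stors_right_perp\<close>.\<close>

lemma stors_left_perp:
  assumes s: "(\<T>, \<F>) \<in> stors D \<X>" and C: "C \<in> \<X>" "hom_vanishes D {C} \<F>"
  shows "C \<in> \<T>"
proof -
  obtain A B f g h where t: "A \<in> \<T>" "B \<in> \<F>" "dist_triangle D A C B f g h"
    using C(1)[unfolded storsD(7)[OF s]] by (rule starE)
  have "g = hom_zero D C B"
    using C(2) t(2) dist_triangleD(2)[OF t(3)] unfolding hom_vanishes_def by blast
  moreover have "\<forall>b \<in> Hom D A (unshift B). b = hom_zero D A (unshift B)"
    using storsD(6)[OF s] t(1,2) unfolding hom_vanishes_def unshift_class_eq by blast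
  ultimately have "is_iso D A C f" using iso_if_second_zero[OF t(3)] by blast
  then show ?thesis
    using storsD(3)[OF s] t(1) dist_triangleD(5)[OF t(3)] unfolding iso_closed_def by blast
qed

lemma stors_right_perp:
  assumes s: "(\<T>, \<F>) \<in> stors D \<X>" and C: "C \<in> \<X>" "hom_vanishes D \<T> {C}"
  shows "C \<in> \<F>"
proof -
  obtain A B f g h where t: "A \<in> \<T>" "B \<in> \<F>" "dist_triangle D A C B f g h"
    using C(1)[unfolded storsD(7)[OF s]] by (rule starE)
  note d = dist_triangleD[OF t(3)]
  have "f = hom_zero D A C" using C(2) t(1) d(1) unfolding hom_vanishes_def by blast
  moreover have "\<forall>b \<in> Hom D A (unshift B). b = hom_zero D A (unshift B)"
    using storsD(6)[OF s] t(1,2) unfolding hom_vanishes_def unshift_class_eq by blast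
  ultimately have "is_iso D C B g" using iso_if_first_zero[OF t(3)] by blast
  then obtain g' where "is_iso D B C g'" using is_iso_sym by blast
  then show ?thesis using storsD(4)[OF s] t(2) d(5) unfolding iso_closed_def by blast
qed

text \<open>A zero object is perpendicular to every class on both sides, so both perpendicularity
  lemmas apply.\<close>

lemma zero_object_in_stors:
  assumes s: "(\<T>, \<F>) \<in> stors D \<X>" and "\<X> \<subseteq> obj D" and Z: "is_zero_object D Z" "Z \<in> \<X>"
  shows "Z \<in> \<T>" "Z \<in> \<F>"
proof -
  have o: "\<T> \<subseteq> obj D" "\<F> \<subseteq> obj D" "{Z} \<subseteq> obj D"
    using storsD[OF s] assms by auto
  have "hom_vanishes D {Z} \<F>"
    unfolding hom_vanishes_iff[OF o(3,2)] using zero_object_from[OF Z(1)] by blast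
  then show "Z \<in> \<T>" using stors_left_perp[OF s Z(2)] by blast
  have "hom_vanishes D \<T> {Z}"
    unfolding hom_vanishes_iff[OF o(1,3)] using zero_object_to[OF Z(1)] by blast
  then show "Z \<in> \<F>" using stors_right_perp[OF s Z(2)] by blast
qed

section \<open>Pairs in the whole category: closure properties, translates, and t-structures\<close>

lemma stors_obj_subset:
  assumes "(\<U>, \<V>) \<in> stors D (obj D)"
  shows "\<U> \<subseteq> obj D" "\<V> \<subseteq> obj D"
  using storsD[OF assms] by auto

text \<open>In the whole category, membership in the ambient class is automatic, so inclusions
  follow from vanishing of Hom alone. The closure properties below rest on this and on its
  dual.\<close>

lemma stors_obj_leftI:
  assumes s: "(\<U>, \<V>) \<in> stors D (obj D)" and "\<A> \<subseteq> obj D" "hom_vanishes D \<A> \<V>"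
  shows "\<A> \<subseteq> \<U>"
  using stors_left_perp[OF s] assms(2,3) unfolding hom_vanishes_def by blast

lemma stors_obj_rightI:
  assumes s: "(\<U>, \<V>) \<in> stors D (obj D)" and "\<A> \<subseteq> obj D" "hom_vanishes D \<U> \<A>"
  shows "\<A> \<subseteq> \<V>"
  using stors_right_perp[OF s] assms(2,3) unfolding hom_vanishes_def by blast

text \<open>The second vanishing condition says that the shift of \<open>\<U>\<close> is left
  perpendicular to \<open>\<V>\<close>, and that the inverse shift of \<open>\<V>\<close> is right
  perpendicular to \<open>\<U>\<close>.\<close>

lemma stors_obj_shift_closed:
  assumes s: "(\<U>, \<V>) \<in> stors D (obj D)"
  shows "shift_class D \<U> \<subseteq> \<U>" "unshift_class D \<V> \<subseteq> \<V>"
proof -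
  note o = stors_obj_subset[OF s]
  have "hom_vanishes D (shift_class D \<U>) \<V>" using hom_vanishes_shift[OF o] storsD(6)[OF s] by simp
  then show "shift_class D \<U> \<subseteq> \<U>"
    using stors_obj_leftI[OF s shift_class_subset_obj[OF o(1)]] by simp
  show "unshift_class D \<V> \<subseteq> \<V>"
    using stors_obj_rightI[OF s unshift_class_subset_obj[OF o(2)] storsD(6)[OF s]] .
qed

lemma stors_obj_ext_closed:
  assumes s: "(\<U>, \<V>) \<in> stors D (obj D)"
  shows "\<U> \<star> \<U> \<subseteq> \<U>" "\<V> \<star> \<V> \<subseteq> \<V>"
proof -
  note o = stors_obj_subset[OF s] and h = storsD(5)[OF s]
  show "\<U> \<star> \<U> \<subseteq> \<U>"
    using stors_obj_leftI[OF s star_subset_obj hom_vanishes_star_left[OF o(2) h h]] .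
  show "\<V> \<star> \<V> \<subseteq> \<V>"
    using stors_obj_rightI[OF s star_subset_obj hom_vanishes_star_right[OF o(1) h h]] .
qed

lemma stors_obj_antimono:
  assumes s: "(\<U>, \<V>) \<in> stors D (obj D)" and s': "(\<U>', \<V>') \<in> stors D (obj D)" and "\<U> \<subseteq> \<U>'"
  shows "\<V>' \<subseteq> \<V>"
  using stors_obj_rightI[OF s stors_obj_subset(2)[OF s']]
    hom_vanishes_mono[OF storsD(5)[OF s'] assms(3) subset_refl] by blast

text \<open>Unrotating exhibits \<open>A\<close> as an extension of \<open>C\<close> by
  \<open>unshift B\<close>, both in \<open>\<V>\<close>.\<close>

lemma stors_obj_right_kernel:
  assumes s: "(\<U>, \<V>) \<in> stors D (obj D)" and t: "dist_triangle D A C B f g h"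
    and "C \<in> \<V>" "B \<in> \<V>"
  shows "A \<in> \<V>"
proof -
  obtain k where "dist_triangle D (unshift B) A C k f g" using unrotate[OF t] .
  moreover have "unshift B \<in> \<V>"
    using stors_obj_shift_closed(2)[OF s] assms(4) unfolding unshift_class_eq by blast
  ultimately show ?thesis using stors_obj_ext_closed(2)[OF s] starI[OF _ _ assms(3)] by blast
qed

text \<open>Rotating exhibits \<open>B\<close> as an extension of \<open>shift D A\<close> by
  \<open>C\<close>, both in \<open>\<U>\<close>.\<close>

lemma stors_obj_left_cone:
  assumes s: "(\<U>, \<V>) \<in> stors D (obj D)" and t: "dist_triangle D A C B f g h"
    and "A \<in> \<U>" "C \<in> \<U>"
  shows "B \<in> \<U>"
proof -
  have "shift D A \<in> \<U>"
    using stors_obj_shift_closed(1)[OF s] assms(3) unfolding shift_class_def by blast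
  then show ?thesis using stors_obj_ext_closed(1)[OF s] starI[OF rotate[OF t] assms(4)] by blast
qed

text \<open>The shift is an automorphism and carries each defining condition along. The translates
  serve as ends of the intervals used for tilting.\<close>

lemma stors_obj_shift:
  assumes s: "(\<U>, \<V>) \<in> stors D (obj D)"
  shows "(shift_class D \<U>, shift_class D \<V>) \<in> stors D (obj D)"
proof (rule storsI)
  note o = stors_obj_subset[OF s]
  note so = shift_class_subset_obj[OF o(1)] shift_class_subset_obj[OF o(2)]
  show "shift_class D \<U> \<subseteq> obj D" "shift_class D \<V> \<subseteq> obj D" using so by auto
  show "iso_closed D (shift_class D \<U>)" "iso_closed D (shift_class D \<V>)"
    using iso_closed_shift_class o storsD(3,4)[OF s] by auto
  show "hom_vanishes D (shift_class D \<U>) (shift_class D \<V>)"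
    using hom_vanishes_shift[OF o(1) so(2)] unshift_shift_class[OF o(2)] storsD(5)[OF s] by simp
  show "hom_vanishes D (shift_class D \<U>) (unshift_class D (shift_class D \<V>))"
    using hom_vanishes_shift[OF o] unshift_shift_class[OF o(2)] storsD(6)[OF s] by simp
  have "obj D = shift_class D (obj D)"
    using shift_bij unfolding shift_class_def by (simp add: bij_betw_def)
  then show "obj D = shift_class D \<U> \<star> shift_class D \<V>"
    using shift_class_star[OF o] storsD(7)[OF s] by simp
qed

lemma stors_obj_unshift:
  assumes s: "(\<U>, \<V>) \<in> stors D (obj D)"
  shows "(unshift_class D \<U>, unshift_class D \<V>) \<in> stors D (obj D)"
proof (rule storsI)
  note o = stors_obj_subset[OF s]
  note uo = unshift_class_subset_obj[OF o(1)] unshift_class_subset_obj[OF o(2)]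
  show "unshift_class D \<U> \<subseteq> obj D" "unshift_class D \<V> \<subseteq> obj D" using uo by auto
  show "iso_closed D (unshift_class D \<U>)" "iso_closed D (unshift_class D \<V>)"
    using iso_closed_unshift_class o storsD(3,4)[OF s] by auto
  show "hom_vanishes D (unshift_class D \<U>) (unshift_class D \<V>)"
    using hom_vanishes_shift[OF uo(1) o(2)] shift_unshift_class[OF o(1)] storsD(5)[OF s] by simp
  show "hom_vanishes D (unshift_class D \<U>) (unshift_class D (unshift_class D \<V>))"
    using hom_vanishes_shift[OF uo] shift_unshift_class[OF o(1)] storsD(6)[OF s] by simp
  have "obj D = unshift_class D (obj D)"
    using unshift_shift_class[OF subset_refl] shift_bij unfolding shift_class_def
    by (simp add: bij_betw_def)
  then show "obj D = unshift_class D \<U> \<star> unshift_class D \<V>"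
    using unshift_class_star[OF o] storsD(7)[OF s] by simp
qed

text \<open>The two notions differ in one condition: closure of \<open>\<U>\<close> under the shift
  on one side, the second vanishing condition on the other. Given the first vanishing condition, the
  former yields the latter by \<open>hom_vanishes_shift\<close>, and
  \<open>stors_obj_shift_closed\<close> gives the converse.\<close>

lemma t_structure_iff_stors_obj:
  "t_structure D (\<U>, \<W>) \<longleftrightarrow> \<W> \<subseteq> obj D \<and> (\<U>, unshift_class D \<W>) \<in> stors D (obj D)"
proof
  assume "t_structure D (\<U>, \<W>)"
  then have t: "\<U> \<subseteq> obj D" "\<W> \<subseteq> obj D" "iso_closed D \<U>" "iso_closed D \<W>"
    "shift_class D \<U> \<subseteq> \<U>" "hom_vanishes D \<U> (unshift_class D \<W>)"
    "obj D = \<U> \<star> unshift_class D \<W>"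
    unfolding t_structure_def by auto
  note o = unshift_class_subset_obj[OF t(2)]
  have "hom_vanishes D \<U> (unshift_class D (unshift_class D \<W>))"
    using hom_vanishes_shift[OF t(1) o] hom_vanishes_mono[OF t(6,5) subset_refl] by blast
  then show "\<W> \<subseteq> obj D \<and> (\<U>, unshift_class D \<W>) \<in> stors D (obj D)"
    using storsI[OF t(1) o t(3) iso_closed_unshift_class[OF t(2,4)] t(6) _ t(7)] t(2) by blast
next
  assume a: "\<W> \<subseteq> obj D \<and> (\<U>, unshift_class D \<W>) \<in> stors D (obj D)"
  then have s: "(\<U>, unshift_class D \<W>) \<in> stors D (obj D)" by blast
  have "iso_closed D \<W>"
    using iso_closed_shift_class[OF stors_obj_subset(2)[OF s] storsD(4)[OF s]]
      shift_unshift_class a by simp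
  then show "t_structure D (\<U>, \<W>)"
    unfolding t_structure_def
    using a storsD[OF s] stors_obj_shift_closed(1)[OF s] by auto
qed

end

subsection \<open>Intervals of \<open>t\<close>-structures\<close>

locale stors_interval = triangulated_category D
  for D :: "('o, 'm, 'e) triangulated_category_scheme" (structure) +
  fixes U1 V1 U2 V2 :: "'o set"
  assumes stors1: "(U1, V1) \<in> stors D (obj D)"
    and stors2: "(U2, V2) \<in> stors D (obj D)"
    and U1_le_U2: "U1 \<subseteq> U2"
begin

lemmas U1_obj = stors_obj_subset(1)[OF stors1]
  and V1_obj = stors_obj_subset(2)[OF stors1]
  and U2_obj = stors_obj_subset(1)[OF stors2]
  and V2_obj = stors_obj_subset(2)[OF stors2]

lemma V2_le_V1: "V2 \<subseteq> V1"
  using stors_obj_antimono[OF stors1 stors2 U1_le_U2] .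

text \<open>Decompose \<open>C\<close> by the second pair. Its \<open>U2\<close>-part stays in
  \<open>V1\<close>, being the first term of a triangle whose other terms lie in
  \<open>V1\<close>.\<close>

lemma V1_subset: "V1 \<subseteq> (U2 \<inter> V1) \<star> V2"
proof
  fix C assume C: "C \<in> V1"
  then have "C \<in> U2 \<star> V2" using V1_obj storsD(7)[OF stors2] by blast
  then obtain A B f g h where t: "A \<in> U2" "B \<in> V2" "dist_triangle D A C B f g h" by (rule starE)
  have "A \<in> V1" using stors_obj_right_kernel[OF stors1 t(3) C] t(2) V2_le_V1 by blast
  then show "C \<in> (U2 \<inter> V1) \<star> V2" using starI[OF t(3)] t(1,2) by blast
qed

lemma zero_objects:
  assumes "(T, F) \<in> stors D (U2 \<inter> V1)" "is_zero_object D Z"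
  shows "Z \<in> U1" "Z \<in> V2" "Z \<in> T" "Z \<in> F"
proof -
  have "Z \<in> obj D" using assms(2) unfolding is_zero_object_def by blast
  note z = zero_object_in_stors[OF _ subset_refl assms(2) this]
  show "Z \<in> U1" "Z \<in> V2" using z stors1 stors2 by blast+
  have "Z \<in> U2 \<inter> V1" using z stors1 stors2 by blast
  then show "Z \<in> T" "Z \<in> F"
    using zero_object_in_stors[OF assms(1) _ assms(2)] U2_obj by blast+
qed

lemma glue_bounds:
  assumes s: "(T, F) \<in> stors D (U2 \<inter> V1)"
  shows "U1 \<subseteq> U1 \<star> T" "U1 \<star> T \<subseteq> U2"
proof -
  obtain Z where Z: "is_zero_object D Z" using ex_zero_object by blast
  show "U1 \<subseteq> U1 \<star> T" using subset_star_left[OF U1_obj Z] zero_objects(3)[OF s Z] by blast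
  have "U1 \<star> T \<subseteq> U2 \<star> U2" using star_mono[OF U1_le_U2] storsD(1)[OF s] by blast
  then show "U1 \<star> T \<subseteq> U2" using stors_obj_ext_closed(1)[OF stors2] by blast
qed

lemma glue_in_stors:
  assumes s: "(T, F) \<in> stors D (U2 \<inter> V1)"
  shows "(U1 \<star> T, F \<star> V2) \<in> stors D (obj D)"
proof (rule storsI[OF star_subset_obj star_subset_obj iso_closed_star iso_closed_star])
  have sub: "T \<subseteq> U2" "T \<subseteq> V1" "F \<subseteq> U2" "F \<subseteq> V1" using storsD(1,2)[OF s] by auto
  have o: "T \<subseteq> obj D" "F \<subseteq> obj D" using sub U2_obj by auto
  \<comment> \<open>Vanishing between extensions is checked on four pairs of factors:
    \<open>U1\<close> against \<open>F\<close> and \<open>V2\<close> because both lie in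
    \<open>V1\<close>, \<open>T\<close> against \<open>F\<close> by \<open>s\<close>, and
    \<open>T\<close> against \<open>V2\<close> because \<open>T \<subseteq> U2\<close>.\<close>
  have v: "hom_vanishes D (U1 \<star> T) (A \<star> B)"
    if "hom_vanishes D U1 A" "hom_vanishes D U1 B"
      "hom_vanishes D T A" "hom_vanishes D T B" for A B
    using hom_vanishes_star_left[OF star_subset_obj hom_vanishes_star_right[OF U1_obj that(1,2)]
      hom_vanishes_star_right[OF o(1) that(3,4)]] .
  show "hom_vanishes D (U1 \<star> T) (F \<star> V2)"
    using v[OF hom_vanishes_mono[OF storsD(5)[OF stors1] subset_refl sub(4)]
      hom_vanishes_mono[OF storsD(5)[OF stors1] subset_refl V2_le_V1] storsD(5)[OF s]
      hom_vanishes_mono[OF storsD(5)[OF stors2] sub(1) subset_refl]] .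
  have uv: "unshift_class D F \<subseteq> unshift_class D V1"
    "unshift_class D V2 \<subseteq> unshift_class D V1"
    using unshift_class_mono sub V2_le_V1 by auto
  show "hom_vanishes D (U1 \<star> T) (unshift_class D (F \<star> V2))"
    unfolding unshift_class_star[OF o(2) V2_obj]
    using v[OF hom_vanishes_mono[OF storsD(6)[OF stors1] subset_refl uv(1)]
      hom_vanishes_mono[OF storsD(6)[OF stors1] subset_refl uv(2)] storsD(6)[OF s]
      hom_vanishes_mono[OF storsD(6)[OF stors2] sub(1) subset_refl]] .
  \<comment> \<open>Decompose by the first pair, its \<open>V1\<close>-part by the second pair, the
    resulting middle part by \<open>(T, F)\<close>, and then reassociate.\<close>
  have "obj D \<subseteq> U1 \<star> ((T \<star> F) \<star> V2)"
    using storsD(7)[OF stors1] star_mono[OF subset_refl V1_subset] storsD(7)[OF s] by metis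
  also have "\<dots> = (U1 \<star> T) \<star> (F \<star> V2)" by (simp add: star_assoc)
  finally show "obj D = (U1 \<star> T) \<star> (F \<star> V2)" using star_subset_obj by blast
qed

text \<open>An object of \<open>U1 \<star> T\<close> in \<open>V1\<close> lies in
  \<open>U2 \<inter> V1\<close> and has no maps to \<open>F\<close>, as
  \<open>F \<subseteq> F \<star> V2\<close>; perpendicularity within \<open>U2 \<inter> V1\<close>
  puts it in \<open>T\<close>. The second identity is dual.\<close>

lemma cut_glue:
  assumes s: "(T, F) \<in> stors D (U2 \<inter> V1)"
  shows "(U1 \<star> T) \<inter> V1 = T" "U2 \<inter> (F \<star> V2) = F"
proof -
  note g = glue_in_stors[OF s]
  have sub: "T \<subseteq> U2" "T \<subseteq> V1" "F \<subseteq> U2" "F \<subseteq> V1" using storsD(1,2)[OF s] by auto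
  have o: "T \<subseteq> obj D" "F \<subseteq> obj D" using sub U2_obj by auto
  obtain Z where Z: "is_zero_object D Z" using ex_zero_object by blast
  \<comment> \<open>Zero objects on both sides of the shift are needed: \<open>Z\<close> in
    \<open>V2\<close> for \<open>F\<close>, and \<open>unshift Z\<close> in \<open>U1\<close> for
    \<open>T\<close>.\<close>
  note z = zero_objects[OF s Z] zero_objects[OF s zero_object_unshift[OF Z]]
  have T: "T \<subseteq> U1 \<star> T" using subset_star_right[OF o(1) Z z(5)] .
  have F: "F \<subseteq> F \<star> V2" using subset_star_left[OF o(2) Z z(2)] .
  have "C \<in> T" if C: "C \<in> U1 \<star> T" "C \<in> V1" for C
    using stors_left_perp[OF s, of C] C glue_bounds(2)[OF s]
      hom_vanishes_mono[OF storsD(5)[OF g], of "{C}" F] F by blast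
  then show "(U1 \<star> T) \<inter> V1 = T" using T sub(2) by blast
  have "F \<star> V2 \<subseteq> V1"
    using star_mono[OF sub(4) V2_le_V1] stors_obj_ext_closed(2)[OF stors1] by blast
  then have "C \<in> F" if C: "C \<in> F \<star> V2" "C \<in> U2" for C
    using stors_right_perp[OF s, of C] C
      hom_vanishes_mono[OF storsD(5)[OF g], of T "{C}"] T by blast
  then show "U2 \<inter> (F \<star> V2) = F" using F sub(3) by blast
qed

text \<open>The triangle of \<open>C\<close> for \<open>(U, V)\<close> already lies in
  \<open>U2 \<inter> V1\<close>: its first term is in \<open>V1\<close> as a kernel, its last term
  in \<open>U2\<close> as a cone.\<close>

lemma cut_in_stors:
  assumes s: "(U, V) \<in> stors D (obj D)" and le: "U1 \<subseteq> U" "U \<subseteq> U2"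
  shows "(U \<inter> V1, U2 \<inter> V) \<in> stors D (U2 \<inter> V1)"
proof (rule storsI)
  have V: "V \<subseteq> V1" using stors_obj_antimono[OF stors1 s le(1)] .
  show "U \<inter> V1 \<subseteq> U2 \<inter> V1" "U2 \<inter> V \<subseteq> U2 \<inter> V1" using le V by auto
  show "iso_closed D (U \<inter> V1)" "iso_closed D (U2 \<inter> V)"
    using iso_closed_Int[OF storsD(3)[OF s] storsD(4)[OF stors1]]
      iso_closed_Int[OF storsD(3)[OF stors2] storsD(4)[OF s]] .
  show "hom_vanishes D (U \<inter> V1) (U2 \<inter> V)"
    using hom_vanishes_mono[OF storsD(5)[OF s] Int_lower1 Int_lower2] .
  show "hom_vanishes D (U \<inter> V1) (unshift_class D (U2 \<inter> V))"
    using hom_vanishes_mono[OF storsD(6)[OF s] Int_lower1 unshift_class_mono[OF Int_lower2]] .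
  show "U2 \<inter> V1 = (U \<inter> V1) \<star> (U2 \<inter> V)"
  proof
    have "(U \<inter> V1) \<star> (U2 \<inter> V) \<subseteq> U2 \<star> U2" by (rule star_mono) (use le in auto)
    moreover have "(U \<inter> V1) \<star> (U2 \<inter> V) \<subseteq> V1 \<star> V1" by (rule star_mono) (use V in auto)
    ultimately show "(U \<inter> V1) \<star> (U2 \<inter> V) \<subseteq> U2 \<inter> V1"
      using stors_obj_ext_closed(1)[OF stors2] stors_obj_ext_closed(2)[OF stors1] by blast
    show "U2 \<inter> V1 \<subseteq> (U \<inter> V1) \<star> (U2 \<inter> V)"
    proof
      fix C assume C: "C \<in> U2 \<inter> V1"
      then have "C \<in> U \<star> V" using U2_obj storsD(7)[OF s] by blast
      then obtain A B f g h where t: "A \<in> U" "B \<in> V" "dist_triangle D A C B f g h"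
        by (rule starE)
      have "A \<in> V1" using stors_obj_right_kernel[OF stors1 t(3)] C t(2) V by blast
      moreover have "B \<in> U2" using stors_obj_left_cone[OF stors2 t(3)] C t(1) le(2) by blast
      ultimately show "C \<in> (U \<inter> V1) \<star> (U2 \<inter> V)" using starI[OF t(3)] t(1,2) by blast
    qed
  qed
qed

text \<open>An object of \<open>U\<close> is decomposed by the first pair, whose second part stays
  in \<open>U\<close> as a cone; an object of \<open>V\<close> by the second pair, whose first part
  stays in \<open>V\<close> as a kernel.\<close>

lemma glue_cut:
  assumes s: "(U, V) \<in> stors D (obj D)" and le: "U1 \<subseteq> U" "U \<subseteq> U2"
  shows "U1 \<star> (U \<inter> V1) = U" "(U2 \<inter> V) \<star> V2 = V"
proof -
  have V: "V2 \<subseteq> V" using stors_obj_antimono[OF s stors2 le(2)] .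
  have "U1 \<star> (U \<inter> V1) \<subseteq> U \<star> U" by (rule star_mono) (use le in auto)
  moreover have "(U2 \<inter> V) \<star> V2 \<subseteq> V \<star> V" by (rule star_mono) (use V in auto)
  ultimately have sub: "U1 \<star> (U \<inter> V1) \<subseteq> U" "(U2 \<inter> V) \<star> V2 \<subseteq> V"
    using stors_obj_ext_closed[OF s] by auto
  have "C \<in> U1 \<star> (U \<inter> V1)" if C: "C \<in> U" for C
  proof -
    have "C \<in> U1 \<star> V1" using C storsD(7)[OF stors1] stors_obj_subset(1)[OF s] by blast
    then obtain A B f g h where t: "A \<in> U1" "B \<in> V1" "dist_triangle D A C B f g h"
      by (rule starE)
    have "B \<in> U" using stors_obj_left_cone[OF s t(3) _ C] t(1) le(1) by blast
    then show ?thesis using starI[OF t(3)] t(1,2) by blast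
  qed
  then show "U1 \<star> (U \<inter> V1) = U" using sub(1) by blast
  have "C \<in> (U2 \<inter> V) \<star> V2" if C: "C \<in> V" for C
  proof -
    have "C \<in> U2 \<star> V2" using C storsD(7)[OF stors2] stors_obj_subset(2)[OF s] by blast
    then obtain A B f g h where t: "A \<in> U2" "B \<in> V2" "dist_triangle D A C B f g h"
      by (rule starE)
    have "A \<in> V" using stors_obj_right_kernel[OF s t(3) C] t(2) V by blast
    then show ?thesis using starI[OF t(3)] t(1,2) by blast
  qed
  then show "(U2 \<inter> V) \<star> V2 = V" using sub(2) by blast
qed

end

subsection \<open>Tilting at a \<open>t\<close>-structure\<close>

locale tilting = triangulated_category D
  for D :: "('o, 'm, 'e) triangulated_category_scheme" (structure) +
  fixes U W :: "'o set"
  assumes t_structure: "t_structure D (U, W)"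
begin

abbreviation "V \<equiv> unshift_class D W"

lemma W_obj: "W \<subseteq> obj D" and stors_UV: "(U, V) \<in> stors D (obj D)"
  using t_structure t_structure_iff_stors_obj by auto

lemma U_obj: "U \<subseteq> obj D" and V_obj: "V \<subseteq> obj D"
  using stors_obj_subset[OF stors_UV] by auto

lemma shift_V: "shift_class D V = W"
  using shift_unshift_class[OF W_obj] .

lemma shift_U_le: "shift_class D U \<subseteq> U"
  using stors_obj_shift_closed(1)[OF stors_UV] .

lemma U_le_unshift_U: "U \<subseteq> unshift_class D U"
  using unshift_class_mono[OF shift_U_le] unshift_shift_class[OF U_obj] by simp

lemma stors_shift_UV: "(shift_class D U, W) \<in> stors D (obj D)"
  using stors_obj_shift[OF stors_UV] shift_V by simp

text \<open>The intervals \<open>E\<close> and \<open>R\<close> share their lower end, so they glue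
  and cut first components identically; they differ only in second components.\<close>

sublocale E: stors_interval D "shift_class D U" W "unshift_class D U" "unshift_class D V"
  using stors_shift_UV stors_obj_unshift[OF stors_UV] shift_U_le U_le_unshift_U
  by unfold_locales auto

sublocale R: stors_interval D "shift_class D U" W U V
  using stors_shift_UV stors_UV shift_U_le by unfold_locales auto

section \<open>Hearts and tilts in terms of the two intervals\<close>

lemma heart_eq: "heart D (U, W) = U \<inter> W"
  by (simp add: heart_def)

lemma extended_heart_eq: "extended_heart D (U, W) = unshift_class D U \<inter> W"
  by (auto simp: extended_heart_def)

lemma unshift_heart: "unshift_class D (U \<inter> W) = unshift_class D U \<inter> V"
  using unshift_class_Int[OF U_obj W_obj] .

lemma stors_ext_plus_iff:
  "(X, Y) \<in> stors_ext_plus D (U, W) \<longleftrightarrow> (X, Y) \<in> stors D (unshift_class D U \<inter> W) \<and> X \<subseteq> U"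
  using storsD(1)[of X Y "unshift_class D U \<inter> W"]
  unfolding stors_ext_plus_def heart_eq extended_heart_eq by auto

lemma T_class_plus_iff:
  "(U', W') \<in> T_class_plus D (U, W) \<longleftrightarrow> W' \<subseteq> obj D \<and>
    (U', unshift_class D W') \<in> stors D (obj D) \<and> shift_class D U \<subseteq> U' \<and> U' \<subseteq> U"
  using U_le_unshift_U t_structure_iff_stors_obj[of U' W']
  unfolding T_class_plus_def T_class_def by auto

text \<open>A t-structure corresponds to a pair whose second component is its inverse shift, so the
  tilt is gluing in \<open>E\<close> followed by a shift of the second component.\<close>

lemma extended_tilt_eq:
  assumes "Y \<subseteq> obj D"
  shows "extended_tilt D (U, W) (X, Y) =
    (shift_class D U \<star> X, shift_class D (Y \<star> unshift_class D V))"
  using shift_class_star[OF assms unshift_class_subset_obj[OF V_obj]] shift_unshift_class[OF V_obj]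
  by (simp add: extended_tilt_def)

lemma right_HRS_tilt_eq:
  assumes "F \<subseteq> obj D"
  shows "right_HRS_tilt D (U, W) (T, F) = (shift_class D U \<star> T, shift_class D (F \<star> V))"
  using shift_class_star[OF assms V_obj] shift_V by (simp add: right_HRS_tilt_def)

text \<open>The right side glues \<open>F\<close> in \<open>R\<close> and cuts the result in
  \<open>E\<close>, which shows \<open>mu_plus\<close> to be a composite of the two. For the harder
  inclusion, the last term of a triangle of \<open>C\<close> lies in
  \<open>unshift_class D U\<close> as a cone.\<close>

lemma star_unshift_heart:
  assumes s: "(T, F) \<in> stors D (U \<inter> W)"
  shows "F \<star> unshift_class D (U \<inter> W) = unshift_class D U \<inter> (F \<star> V)"
  unfolding unshift_heart
proof
  note s2 = stors_obj_unshift[OF stors_UV]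
  have F: "F \<subseteq> unshift_class D U" using storsD(2)[OF s] U_le_unshift_U by blast
  have "F \<star> (unshift_class D U \<inter> V) \<subseteq> unshift_class D U"
    using star_mono[OF F Int_lower1] stors_obj_ext_closed(1)[OF s2] by blast
  then show "F \<star> (unshift_class D U \<inter> V) \<subseteq> unshift_class D U \<inter> (F \<star> V)"
    using star_mono[OF subset_refl Int_lower2] by blast
  show "unshift_class D U \<inter> (F \<star> V) \<subseteq> F \<star> (unshift_class D U \<inter> V)"
  proof
    fix C assume C: "C \<in> unshift_class D U \<inter> (F \<star> V)"
    then have "C \<in> F \<star> V" by blast
    then obtain A B f g h where t: "A \<in> F" "B \<in> V" "dist_triangle D A C B f g h"
      by (rule starE)
    have "B \<in> unshift_class D U" using stors_obj_left_cone[OF s2 t(3)] C t(1) F by blast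
    then show "C \<in> F \<star> (unshift_class D U \<inter> V)" using starI[OF t(3,1)] t(2) by blast
  qed
qed

section \<open>From the heart to the extended heart\<close>

lemma HRS_tilt_bounds:
  assumes s: "(T, F) \<in> stors D (U \<inter> W)"
  shows "(shift_class D U \<star> T, F \<star> V) \<in> stors D (obj D)"
    "shift_class D U \<subseteq> shift_class D U \<star> T" "shift_class D U \<star> T \<subseteq> U"
    "shift_class D U \<star> T \<subseteq> unshift_class D U"
  using R.glue_in_stors[OF s] R.glue_bounds[OF s] U_le_unshift_U by auto

lemma mu_plus_in:
  assumes s: "(T, F) \<in> stors D (U \<inter> W)"
  shows "(T, F \<star> unshift_class D (U \<inter> W)) \<in> stors_ext_plus D (U, W)"
  unfolding stors_ext_plus_iff star_unshift_heart[OF s]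
  using E.cut_in_stors[OF HRS_tilt_bounds(1,2,4)[OF s]] R.cut_glue(1)[OF s] storsD(1)[OF s]
  by auto

text \<open>First components agree by definition. On second components, gluing in \<open>E\<close>
  undoes the cut in \<open>E\<close> and leaves \<open>F \<star> V\<close>, the pair glued in
  \<open>R\<close>.\<close>

lemma extended_tilt_mu_plus:
  assumes s: "(T, F) \<in> stors D (U \<inter> W)"
  shows "extended_tilt D (U, W) (T, F \<star> unshift_class D (U \<inter> W)) = right_HRS_tilt D (U, W) (T, F)"
proof -
  have "F \<subseteq> obj D" using storsD(2)[OF s] U_obj by blast
  then show ?thesis
    using extended_tilt_eq[OF star_subset_obj[of F "unshift_class D (U \<inter> W)"], of T]
    unfolding star_unshift_heart[OF s] E.glue_cut(2)[OF HRS_tilt_bounds(1,2,4)[OF s]]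
    by (simp add: right_HRS_tilt_eq)
qed

lemma mu_plus_cut:
  assumes s: "(T, F) \<in> stors D (U \<inter> W)"
  shows "(F \<star> unshift_class D (U \<inter> W)) \<inter> (U \<inter> W) = F"
  unfolding star_unshift_heart[OF s]
  using R.cut_glue(2)[OF s] U_le_unshift_U storsD(2)[OF s] by blast

section \<open>From the extended heart to the heart\<close>

lemma extended_tilt_bounds:
  assumes "(X, Y) \<in> stors_ext_plus D (U, W)"
  shows "(shift_class D U \<star> X, Y \<star> unshift_class D V) \<in> stors D (obj D)"
    "shift_class D U \<subseteq> shift_class D U \<star> X" "shift_class D U \<star> X \<subseteq> U"
    "(shift_class D U \<star> X) \<inter> W = X" "unshift_class D U \<inter> (Y \<star> unshift_class D V) = Y"
    "Y \<subseteq> obj D" "Y \<subseteq> W"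
proof -
  have s: "(X, Y) \<in> stors D (unshift_class D U \<inter> W)" and X: "X \<subseteq> U"
    using assms unfolding stors_ext_plus_iff by auto
  show "(shift_class D U \<star> X, Y \<star> unshift_class D V) \<in> stors D (obj D)"
    "shift_class D U \<subseteq> shift_class D U \<star> X" "(shift_class D U \<star> X) \<inter> W = X"
    "unshift_class D U \<inter> (Y \<star> unshift_class D V) = Y"
    using E.glue_in_stors[OF s] E.glue_bounds[OF s] E.cut_glue[OF s] by auto
  show "Y \<subseteq> obj D" "Y \<subseteq> W" using storsD(2)[OF s] W_obj by auto
  \<comment> \<open>The condition \<open>X \<subseteq> U\<close> places the pair glued in
    \<open>E\<close> inside the smaller interval \<open>R\<close>, where it can be cut
    again.\<close>
  show "shift_class D U \<star> X \<subseteq> U"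
    using star_mono[OF shift_U_le X] stors_obj_ext_closed(1)[OF stors_UV] by blast
qed

text \<open>Exhibits the second component of \<open>lambda_plus\<close> as the cut in
  \<open>R\<close> of the pair glued in \<open>E\<close>.\<close>

lemma ext_plus_cut:
  assumes "(X, Y) \<in> stors_ext_plus D (U, W)"
  shows "Y \<inter> (U \<inter> W) = U \<inter> (Y \<star> unshift_class D V)"
  using extended_tilt_bounds(5,7)[OF assms] U_le_unshift_U by blast

lemma lambda_plus_in:
  assumes s: "(X, Y) \<in> stors_ext_plus D (U, W)"
  shows "(X, Y \<inter> (U \<inter> W)) \<in> stors D (U \<inter> W)"
  unfolding ext_plus_cut[OF s]
  using R.cut_in_stors[OF extended_tilt_bounds(1,2,3)[OF s]] extended_tilt_bounds(4)[OF s] by simp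

text \<open>By \<open>star_unshift_heart\<close> the left side is glued in \<open>R\<close> and cut
  in \<open>E\<close>. Gluing in \<open>R\<close> undoes the cut of \<open>ext_plus_cut\<close>, and
  the cut in \<open>E\<close> then undoes the original gluing.\<close>

lemma ext_plus_eq_star:
  assumes s: "(X, Y) \<in> stors_ext_plus D (U, W)"
  shows "(Y \<inter> (U \<inter> W)) \<star> unshift_class D (U \<inter> W) = Y"
  unfolding star_unshift_heart[OF lambda_plus_in[OF s]]
  unfolding ext_plus_cut[OF s] R.glue_cut(2)[OF extended_tilt_bounds(1,2,3)[OF s]]
  using extended_tilt_bounds(5)[OF s] .

section \<open>The restricted extended tilt as an isomorphism of posets\<close>

lemma extended_tilt_plus_in:
  assumes s: "(X, Y) \<in> stors_ext_plus D (U, W)"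
  shows "extended_tilt D (U, W) (X, Y) \<in> T_class_plus D (U, W)"
  unfolding extended_tilt_eq[OF extended_tilt_bounds(6)[OF s]] T_class_plus_iff
    unshift_shift_class[OF star_subset_obj]
  using extended_tilt_bounds(1,2,3)[OF s] shift_class_subset_obj[OF star_subset_obj] by blast

lemma extended_tilt_plus_poset_iso:
  "poset_iso (stors_ext_plus D (U, W)) (T_class_plus D (U, W)) (extended_tilt_plus D (U, W))"
proof -
  let ?E = "extended_tilt_plus D (U, W)"
  let ?P = "stors_ext_plus D (U, W)"
  \<comment> \<open>This is the cut in \<open>E\<close>, applied after unshifting the second
    component of the t-structure.\<close>
  let ?inv = "\<lambda>(U', W'). (U' \<inter> W, unshift_class D U \<inter> unshift_class D W')"
  have E: "?E (X, Y) = extended_tilt D (U, W) (X, Y)" if "(X, Y) \<in> ?P" for X Y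
    using that unfolding extended_tilt_plus_def by simp
  have inv1: "?inv (?E (X, Y)) = (X, Y)" if s: "(X, Y) \<in> ?P" for X Y
    using extended_tilt_bounds(4,5)[OF s]
    unfolding E[OF s] extended_tilt_eq[OF extended_tilt_bounds(6)[OF s]]
    by (simp add: unshift_shift_class[OF star_subset_obj])
  have inv2: "?inv (U', W') \<in> ?P \<and> ?E (?inv (U', W')) = (U', W')"
    if t: "(U', W') \<in> T_class_plus D (U, W)" for U' W'
  proof -
    have s: "(U', unshift_class D W') \<in> stors D (obj D)" "shift_class D U \<subseteq> U'"
      "U' \<subseteq> unshift_class D U" and W': "W' \<subseteq> obj D" and U': "U' \<subseteq> U"
      using t U_le_unshift_U unfolding T_class_plus_iff by auto
    have P: "(U' \<inter> W, unshift_class D U \<inter> unshift_class D W') \<in> ?P"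
      unfolding stors_ext_plus_iff using E.cut_in_stors[OF s] U' by blast
    show ?thesis
      using P unfolding case_prod_conv E[OF P] extended_tilt_eq[OF extended_tilt_bounds(6)[OF P]]
        E.glue_cut[OF s] shift_unshift_class[OF W'] by blast
  qed
  have "bij_betw ?E ?P (T_class_plus D (U, W))"
    using inv1 inv2 E extended_tilt_plus_in
    by (intro bij_betw_byWitness[where f' = ?inv]) fastforce+
  moreover have "fst p \<subseteq> fst q \<longleftrightarrow> fst (?E p) \<subseteq> fst (?E q)" if "p \<in> ?P" "q \<in> ?P" for p q
  proof -
    obtain X Y X' Y' where pq: "p = (X, Y)" "q = (X', Y')" by fastforce
    have s: "(X, Y) \<in> ?P" "(X', Y') \<in> ?P" using that pq by auto
    have "fst (?E p) = shift_class D U \<star> X" "fst (?E q) = shift_class D U \<star> X'"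
      unfolding pq E[OF s(1)] E[OF s(2)] by (simp_all add: extended_tilt_def)
    moreover have "X \<subseteq> X' \<Longrightarrow> shift_class D U \<star> X \<subseteq> shift_class D U \<star> X'"
      by (rule star_mono[OF subset_refl])
    \<comment> \<open>The order is reflected because \<open>X\<close> is recovered from its tilt by
      intersecting with \<open>W\<close>.\<close>
    moreover have "X \<subseteq> X'" if "shift_class D U \<star> X \<subseteq> shift_class D U \<star> X'"
      using that extended_tilt_bounds(4)[OF s(1)] extended_tilt_bounds(4)[OF s(2)] by blast
    ultimately show ?thesis unfolding pq by auto
  qed
  ultimately show ?thesis unfolding poset_iso_def by blast
qed

section \<open>The mutually inverse isomorphisms between the two posets of s-torsion pairs\<close>

lemma lambda_plus_mu_plus:
  "p \<in> stors D (U \<inter> W) \<Longrightarrow> lambda_plus D (U, W) (mu_plus D (U, W) p) = p"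
  using mu_plus_cut by (cases p) (simp add: lambda_plus_def mu_plus_def heart_eq)

lemma mu_plus_lambda_plus:
  "q \<in> stors_ext_plus D (U, W) \<Longrightarrow> mu_plus D (U, W) (lambda_plus D (U, W) q) = q"
  using ext_plus_eq_star by (cases q) (simp add: lambda_plus_def mu_plus_def heart_eq)

text \<open>Both maps fix first components, so the order is preserved and reflected at once;
  bijectivity comes from their being mutually inverse.\<close>

lemma mu_plus_poset_iso:
  "poset_iso (stors D (U \<inter> W)) (stors_ext_plus D (U, W)) (mu_plus D (U, W))"
  and lambda_plus_poset_iso:
  "poset_iso (stors_ext_plus D (U, W)) (stors D (U \<inter> W)) (lambda_plus D (U, W))"
proof -
  have m: "mu_plus D (U, W) ` stors D (U \<inter> W) \<subseteq> stors_ext_plus D (U, W)"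
    using mu_plus_in by (auto simp: mu_plus_def heart_eq)
  have l: "lambda_plus D (U, W) ` stors_ext_plus D (U, W) \<subseteq> stors D (U \<inter> W)"
    using lambda_plus_in by (auto simp: lambda_plus_def heart_eq)
  have "fst (mu_plus D (U, W) p) = fst p" "fst (lambda_plus D (U, W) p) = fst p" for p
    by (simp_all add: mu_plus_def lambda_plus_def split: prod.split)
  then show "poset_iso (stors D (U \<inter> W)) (stors_ext_plus D (U, W)) (mu_plus D (U, W))"
    "poset_iso (stors_ext_plus D (U, W)) (stors D (U \<inter> W)) (lambda_plus D (U, W))"
    unfolding poset_iso_def
    using bij_betw_byWitness[OF _ _ m l] bij_betw_byWitness[OF _ _ l m]
      lambda_plus_mu_plus mu_plus_lambda_plus by simp_all
qed

end

theorem theorem4p9: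
  fixes D :: "('o, 'm) triangulated_category"
    and u :: "'o set \<times> 'o set"
  assumes "triangulated_category D"
    and "t_structure D u"
  shows "poset_iso (stors_ext_plus D u) (T_class_plus D u) (extended_tilt_plus D u)
    \<and> (poset_iso (stors D (heart D u)) (stors_ext_plus D u) (mu_plus D u)
      \<and> poset_iso (stors_ext_plus D u) (stors D (heart D u)) (lambda_plus D u)
      \<and> (\<forall>p \<in> stors D (heart D u). lambda_plus D u (mu_plus D u p) = p)
      \<and> (\<forall>q \<in> stors_ext_plus D u. mu_plus D u (lambda_plus D u q) = q)
      \<and> (\<forall>(\<X>, \<Y>) \<in> stors_ext_plus D u.
            \<Y> = (\<Y> \<inter> heart D u) \<star>\<^bsub>D\<^esub> unshift_class D (heart D u))
      \<and> (\<forall>(\<T>, \<F>) \<in> stors D (heart D u).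
            \<F> = (\<F> \<star>\<^bsub>D\<^esub> unshift_class D (heart D u)) \<inter> heart D u))
    \<and> (\<forall>p \<in> stors D (heart D u).
          extended_tilt_plus D u (mu_plus D u p) = right_HRS_tilt D u p)"
proof -
  obtain U W where u: "u = (U, W)" by fastforce
  interpret triangulated_category D by fact
  interpret tilting D U W using assms(2) u by unfold_locales simp
  \<comment> \<open>As \<open>extended_tilt_plus\<close> is a restriction, \<open>mu_plus_in\<close>
    is needed to place the image of \<open>mu_plus\<close> in its domain.\<close>
  have "extended_tilt_plus D u (mu_plus D u p) = right_HRS_tilt D u p"
    if "p \<in> stors D (U \<inter> W)" for p
    using that mu_plus_in extended_tilt_mu_plus unfolding u
    by (cases p) (simp add: extended_tilt_plus_def mu_plus_def heart_eq)
  moreover have "\<forall>(\<X>, \<Y>) \<in> stors_ext_plus D u. \<Y> = (\<Y> \<inter> (U \<inter> W)) \<star>\<^bsub>D\<^esub> unshift_class D (U \<inter> W)"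
    using ext_plus_eq_star unfolding u by fastforce
  moreover have "\<forall>(\<T>, \<F>) \<in> stors D (U \<inter> W). \<F> = (\<F> \<star>\<^bsub>D\<^esub> unshift_class D (U \<inter> W)) \<inter> (U \<inter> W)"
    using mu_plus_cut by fastforce
  ultimately show ?thesis
    using extended_tilt_plus_poset_iso mu_plus_poset_iso lambda_plus_poset_iso
      lambda_plus_mu_plus mu_plus_lambda_plus
    unfolding u heart_eq by (intro conjI ballI) blast+
qed

end
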